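(* Let $p>3$ be a prime with $p\equiv 1 \pmod 3$ such that $X^3-7$ is irreducible over $\mathbb{F}_p$, and let $\mathbb{F}_{p^9}$ be represented by the tower $\mathbb{F}_{p^3}=\mathbb{F}_p[u]$ with $u^3=7$, and $\mathbb{F}_{p^9}=\mathbb{F}_{p^3}[v]$ with $v^3=u=7^{1/3}$. Then, in the finite field $\mathbb{F}_{p^9}$: (1) The computation of each of the $p^3$- and $p^6$-Frobenius maps costs $6M_1$. (2) The computation of each of the $p$-, $p^2$-, $p^4$-, $p^5$-, $p^7$- and $p^8$-Frobenius maps costs $8M_1$. (3) The inverse of an element $\alpha$ of the cyclotomic subgroup $G_{\phi_3(p^3)}$ is computed as $\alpha^{-1}=\alpha^{p^3}\cdot\alpha^{p^6}$, and the cost is $36S_1$.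
   Context: The $p^i$-Frobenius map on $\mathbb{F}_{p^9}$ is $a\mapsto a^{p^i}$. The polynomial $\phi_3(x)=x^2+x+1$ is the third cyclotomic polynomial, and $G_{\phi_3(p^3)}=\{a\in\mathbb{F}_{p^9}^{\ast} : a^{p^6+p^3+1}=1\}$ is the subgroup of $\mathbb{F}_{p^9}^{\ast}$ of order $\phi_3(p^3)=p^6+p^3+1$. Elements of $\mathbb{F}_{p^9}$ are given by their 9 coordinates in $\mathbb{F}_p$ with respect to the basis $u^iv^j$, $0\le i,j\le 2$, and the result of a computation must be given in the same form. $M_1$ and $S_1$ denote the cost of one multiplication and one squaring in $\mathbb{F}_p$, respectively. Saying that a computation costs $xM_1+yS_1$ means that it can be carried out on coordinates by a fixed sequence of arithmetic operations in $\mathbb{F}_p$ using $x$ multiplications and $y$ squarings (an operation count as an upper bound). Not counted are additions, subtractions, and multiplications by fixed small rational constants independent of $p$, such as $7$ or $1/2$. Constants of $\mathbb{F}_p$ depending only on $p$ and on the tower (such as powers of roots of unity) may be precomputed for free, but multiplying a coordinate by such a constant counts as one multiplication $M_1$. *)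

theory Defs
  imports "HOL-Algebra.Algebra" "HOL-Number_Theory.Cong"
begin

section \<open>The tower of fields\<close>

text \<open>\<open>cubic_tower p L K u v\<close>: \<open>L\<close> is a field with \<open>p ^ 9\<close> elements, \<open>K\<close> is its subfield with \<open>p\<close>
  elements, and \<open>K \<subseteq> K[u] \<subseteq> K[u][v] = L\<close> with \<open>u\<^sup>3 = 7\<close> and \<open>v\<^sup>3 = u\<close>.\<close>

definition cubic_tower :: "nat \<Rightarrow> ('a, 'm) ring_scheme \<Rightarrow> 'a set \<Rightarrow> 'a \<Rightarrow> 'a \<Rightarrow> bool" where
  "cubic_tower p L K u v \<longleftrightarrow>
     field L \<and> order L = p ^ 9 \<and>
     subfield K L \<and> card K = p \<and>
     u \<in> carrier L \<and> u [^]\<^bsub>L\<^esub> (3::nat) = add_pow L (7::nat) \<one>\<^bsub>L\<^esub> \<and>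
     card (ring.simple_extension L K u) = p ^ 3 \<and>
     v \<in> carrier L \<and> v [^]\<^bsub>L\<^esub> (3::nat) = u \<and>
     ring.simple_extension L (ring.simple_extension L K u) v = carrier L"

text \<open>Polynomials of HOL-Algebra are coefficient lists, leading coefficient first.\<close>

definition X3_minus_7 :: "('a, 'm) ring_scheme \<Rightarrow> 'a list" where
  "X3_minus_7 L = [\<one>\<^bsub>L\<^esub>, \<zero>\<^bsub>L\<^esub>, \<zero>\<^bsub>L\<^esub>, \<ominus>\<^bsub>L\<^esub> (add_pow L (7::nat) \<one>\<^bsub>L\<^esub>)]"

definition frobenius :: "('a, 'm) ring_scheme \<Rightarrow> nat \<Rightarrow> nat \<Rightarrow> 'a \<Rightarrow> 'a" where
  "frobenius L p i a = a [^]\<^bsub>L\<^esub> (p ^ i)"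

definition G_phi3 :: "('a, 'm) ring_scheme \<Rightarrow> nat \<Rightarrow> 'a set" where
  "G_phi3 L p =
     {a \<in> carrier L - {\<zero>\<^bsub>L\<^esub>}. a [^]\<^bsub>L\<^esub> (p ^ 6 + p ^ 3 + 1) = \<one>\<^bsub>L\<^esub>}"

text \<open>The coordinate of \<open>u\<^sup>i v\<^sup>j\<close> is stored at position \<open>3 * i + j\<close>.\<close>

definition from_coords :: "('a, 'm) ring_scheme \<Rightarrow> 'a \<Rightarrow> 'a \<Rightarrow> 'a list \<Rightarrow> 'a" where
  "from_coords L u v c =
     (\<Oplus>\<^bsub>L\<^esub>i\<in>{..<3::nat}. \<Oplus>\<^bsub>L\<^esub>j\<in>{..<3::nat}.
        c ! (3 * i + j) \<otimes>\<^bsub>L\<^esub> (u [^]\<^bsub>L\<^esub> i \<otimes>\<^bsub>L\<^esub> v [^]\<^bsub>L\<^esub> j))"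

definition coords :: "('a, 'm) ring_scheme \<Rightarrow> 'a set \<Rightarrow> 'a \<Rightarrow> 'a \<Rightarrow> 'a \<Rightarrow> 'a list" where
  "coords L K u v a = (THE c. length c = 9 \<and> set c \<subseteq> K \<and> from_coords L u v c = a)"

section \<open>Straight-line programs over the prime field\<close>

text \<open>The registers initially hold the nine input coordinates followed by the precomputed
  constants; each instruction appends one register.  The arguments of type \<^typ>\<open>nat\<close> are register
  numbers.  \<open>Scale r\<close> is multiplication by a small rational constant, written in the program text
  and hence independent of the field.  Multiplication by a precomputed constant is a \<open>Mul\<close>.\<close>

datatype instr =
    Add nat nat
  | Sub nat nat
  | Scale rat nat
  | is_Mul: Mul nat nat
  | is_Sqr: Sqr nat

datatype slp = SLP (num_consts: nat) (body: "instr list") (outputs: "nat list")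

definition rat_in :: "('a, 'm) ring_scheme \<Rightarrow> rat \<Rightarrow> 'a" where
  "rat_in L r =
     add_pow L (fst (quotient_of r)) \<one>\<^bsub>L\<^esub> \<otimes>\<^bsub>L\<^esub> inv\<^bsub>L\<^esub> (add_pow L (snd (quotient_of r)) \<one>\<^bsub>L\<^esub>)"

text \<open>The bound \<open>7\<close> is just large enough for \<open>7\<close> and \<open>1/2\<close>.  Denominators up to \<open>7\<close> are invertible in
  every characteristic considered, since \<open>X\<^sup>3 - 7\<close> is irreducible modulo \<open>p \<equiv> 1 (mod 3)\<close> only for
  \<open>p > 7\<close>.\<close>

definition small_rat :: "rat \<Rightarrow> bool" where
  "small_rat r \<longleftrightarrow> \<bar>fst (quotient_of r)\<bar> \<le> 7 \<and> snd (quotient_of r) \<le> 7"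

fun step :: "('a, 'm) ring_scheme \<Rightarrow> 'a list \<Rightarrow> instr \<Rightarrow> 'a" where
  "step L rs (Add i j) = rs ! i \<oplus>\<^bsub>L\<^esub> rs ! j"
| "step L rs (Sub i j) = rs ! i \<ominus>\<^bsub>L\<^esub> rs ! j"
| "step L rs (Scale r i) = rat_in L r \<otimes>\<^bsub>L\<^esub> rs ! i"
| "step L rs (Mul i j) = rs ! i \<otimes>\<^bsub>L\<^esub> rs ! j"
| "step L rs (Sqr i) = rs ! i \<otimes>\<^bsub>L\<^esub> rs ! i"

fun exec :: "('a, 'm) ring_scheme \<Rightarrow> instr list \<Rightarrow> 'a list \<Rightarrow> 'a list" where
  "exec L [] rs = rs"
| "exec L (ins # prog) rs = exec L prog (rs @ [step L rs ins])"

definition run :: "('a, 'm) ring_scheme \<Rightarrow> slp \<Rightarrow> 'a list \<Rightarrow> 'a list \<Rightarrow> 'a list" where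
  "run L P ks c = map (\<lambda>i. exec L (body P) (c @ ks) ! i) (outputs P)"

fun wf_instr :: "nat \<Rightarrow> instr \<Rightarrow> bool" where
  "wf_instr n (Add i j) \<longleftrightarrow> i < n \<and> j < n"
| "wf_instr n (Sub i j) \<longleftrightarrow> i < n \<and> j < n"
| "wf_instr n (Scale r i) \<longleftrightarrow> small_rat r \<and> i < n"
| "wf_instr n (Mul i j) \<longleftrightarrow> i < n \<and> j < n"
| "wf_instr n (Sqr i) \<longleftrightarrow> i < n"

definition wf_slp :: "slp \<Rightarrow> bool" where
  "wf_slp P \<longleftrightarrow>
     (\<forall>k < length (body P). wf_instr (9 + num_consts P + k) (body P ! k)) \<and>
     length (outputs P) = 9 \<and>
     (\<forall>i \<in> set (outputs P). i < 9 + num_consts P + length (body P))"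

definition mults :: "slp \<Rightarrow> nat" where
  "mults P = length (filter is_Mul (body P))"

definition squarings :: "slp \<Rightarrow> nat" where
  "squarings P = length (filter is_Sqr (body P))"

text \<open>\<open>f\<close> can be computed on \<open>D\<close> at cost \<open>x M\<^sub>1 + y S\<^sub>1\<close> by one of the programs in \<open>Ps\<close>.  The constants
  \<open>ks\<close> may depend on the tower but not on the input.  Since additions are free, multiplication by
  any element of \<open>K\<close> is free for programs whose length may grow with \<open>p\<close> (repeated doubling);
  to obtain a meaningful count, \<open>Ps\<close> has to be a finite set fixed before \<open>p\<close> is.\<close>

definition costs ::
  "slp set \<Rightarrow> ('a, 'm) ring_scheme \<Rightarrow> 'a set \<Rightarrow> 'a \<Rightarrow> 'a \<Rightarrow> 'a set \<Rightarrow> ('a \<Rightarrow> 'a) \<Rightarrow> nat \<Rightarrow> nat \<Rightarrow> bool" where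
  "costs Ps L K u v D f x y \<longleftrightarrow>
     (\<exists>P\<in>Ps. wf_slp P \<and> mults P \<le> x \<and> squarings P \<le> y \<and>
        (\<exists>ks. length ks = num_consts P \<and> set ks \<subseteq> K \<and>
           (\<forall>a\<in>D. run L P ks (coords L K u v a) = coords L K u v (f a))))"

end

theory Submission
  imports Defs
begin

text \<open>Since \<open>u = v\<^sup>3\<close> and \<open>v\<^sup>9 = 7\<close>, the basis \<open>u\<^sup>i v\<^sup>j\<close> consists of the powers \<open>v ^ k\<close> with \<open>k < 9\<close>.  The field
  with \<open>p ^ 9\<close> elements is spanned by them over the prime field \<open>K\<close>, and a count shows that
  coordinates are unique.

  Frobenius maps.  Let \<open>q = p ^ i\<close>.  Raising to the power \<open>q\<close> is additive and fixes \<open>K\<close>, and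
  \<open>v ^ (k q) = 7 ^ (k q div 9) v ^ (k q mod 9)\<close>.  So the map permutes the coordinates and multiplies
  each by a constant, which is \<open>1\<close> at \<open>k = 0\<close>: eight multiplications.  As \<open>q \<equiv> 1 (mod 3)\<close>, the
  permutation is one of three, given by \<open>q mod 9 \<in> {1, 4, 7}\<close> (\<open>frobenius_from_coords\<close>).  If \<open>3\<close>
  divides \<open>i\<close>, then \<open>q \<equiv> 1 (mod 9)\<close>, and the constants at \<open>k = 3\<close> and \<open>k = 6\<close> are powers of
  \<open>7 ^ (p - 1) = 1\<close> (\<open>cube_factor\<close>); six multiplications remain.

  Inversion.  For \<open>\<alpha>\<close> in the cyclotomic subgroup the formula for the inverse is
  \<open>\<alpha> ^ (p ^ 6 + p ^ 3 + 1) = 1\<close>.  Let \<open>\<alpha> = A + B v + C v\<^sup>2\<close> with \<open>A, B, C\<close> in \<open>K[u]\<close>.  The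
  \<open>p ^ 3\<close>-Frobenius map fixes \<open>K[u]\<close> and multiplies \<open>v\<close> by a primitive cube root of unity
  (\<open>frobenius_3_generator\<close>), so the product of the two conjugates of \<open>\<alpha>\<close> is
  \<open>(A\<^sup>2 - u B C) + (u C\<^sup>2 - A B) v + (B\<^sup>2 - A C) v\<^sup>2\<close> (\<open>conjugates_product\<close>).  By polarization,
  \<open>2 X Y = (X + Y)\<^sup>2 - X\<^sup>2 - Y\<^sup>2\<close>, this is a linear combination of the squares of the six elements
  \<open>A, B, C, A + B, A + C, B + C\<close> of \<open>K[u]\<close>.  By the same identity each of these squares is a linear
  combination of six squares in \<open>K\<close> (\<open>sq_triple\<close>), which makes \<open>36\<close> squarings and no
  multiplication.

  The programs are independent of the field: three for the general Frobenius maps, one for the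
  \<open>p ^ 3\<close>- and \<open>p ^ 6\<close>-Frobenius maps and one for inversion.  The last one is obtained by compiling
  linear expressions (\<open>quad_slp_correct\<close>).\<close>

section \<open>Identities in commutative rings\<close>

lemma (in cring) binomial_expansion:
  assumes ab: "a \<in> carrier R" "b \<in> carrier R"
  shows "(a \<oplus> b) [^] n = (\<Oplus>k\<in>{..n}. add_pow R (n choose k) (a [^] k \<otimes> b [^] (n - k)))"
proof (induction n)
  case 0
  show ?case using ab by simp
next
  case (Suc n)
  let ?S = "\<Oplus>k\<in>{..n}. add_pow R (n choose k) (a [^] k \<otimes> b [^] (n - k))"
  have aS: "a \<otimes> ?S = (\<Oplus>k\<in>{..n}. add_pow R (n choose k) (a [^] Suc k \<otimes> b [^] (n - k)))"
    using ab by (subst finsum_rdistr) (auto simp: add_pow_rdistr m_ac intro!: finsum_cong')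
  have "b \<otimes> ?S = (\<Oplus>k\<in>{..n}. add_pow R (n choose k) (a [^] k \<otimes> b [^] (Suc n - k)))"
    using ab by (subst finsum_rdistr)
      (auto simp: add_pow_rdistr m_ac Suc_diff_le intro!: finsum_cong')
  also have "\<dots> = (\<Oplus>k\<in>{..Suc n}. add_pow R (n choose k) (a [^] k \<otimes> b [^] (Suc n - k)))"
    using ab by (subst finsum_Suc) (auto simp: binomial_eq_0)
  also have "\<dots> = (\<Oplus>k\<in>{..n}. add_pow R (n choose Suc k) (a [^] Suc k \<otimes> b [^] (n - k))) \<oplus> b [^] Suc n"
    using ab by (subst finsum_Suc2) (auto simp del: nat_pow_Suc)
  finally have bS: "b \<otimes> ?S = \<dots>" .
  have "(a \<oplus> b) [^] Suc n = a \<otimes> ?S \<oplus> b \<otimes> ?S"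
    using ab by (simp add: Suc l_distr m_comm)
  also have "\<dots> = (\<Oplus>k\<in>{..n}. add_pow R (Suc n choose Suc k) (a [^] Suc k \<otimes> b [^] (n - k))) \<oplus> b [^] Suc n"
    unfolding aS bS using ab
    by (simp add: finsum_addf add.nat_pow_mult[symmetric] a_assoc del: nat_pow_Suc)
  also have "\<dots> = (\<Oplus>k\<in>{..Suc n}. add_pow R (Suc n choose k) (a [^] k \<otimes> b [^] (Suc n - k)))"
    using ab by (subst finsum_Suc2) (auto simp del: nat_pow_Suc)
  finally show ?case .
qed

lemma (in cring) frobenius_add:
  assumes p: "Factorial_Ring.prime (p::nat)" and char: "add_pow R p \<one> = \<zero>"
    and ab: "a \<in> carrier R" "b \<in> carrier R"
  shows "(a \<oplus> b) [^] (p ^ i) = a [^] (p ^ i) \<oplus> b [^] (p ^ i)"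
  using ab
proof (induction i arbitrary: a b)
  case (Suc i)
  \<comment> \<open>Multiples of \<open>p\<close> annihilate the ring, so only the two extreme binomial terms survive.\<close>
  have kill: "add_pow R k c = \<zero>" if "p dvd k" "c \<in> carrier R" for k c
  proof -
    from that(1) obtain m where "k = p * m" ..
    then have "add_pow R k \<one> = \<zero>"
      using add.nat_pow_pow[of \<one> m p] by (simp add: char mult.commute)
    then show ?thesis
      using add_pow_ldistr[of \<one> c k] that(2) by simp
  qed
  have step: "(x \<oplus> y) [^] p = x [^] p \<oplus> y [^] p"
    if xy: "x \<in> carrier R" "y \<in> carrier R" for x y
  proof -
    obtain n where n: "p = Suc n" using p by (metis not0_implies_Suc not_prime_0)
    have z: "add_pow R (p choose Suc k) (x [^] Suc k \<otimes> y [^] (p - Suc k)) = \<zero>" if "k < n" for k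
      using that xy by (intro kill dvd_choose_prime) (use p in \<open>auto simp: n simp del: nat_pow_Suc\<close>)
    have "(\<Oplus>k\<in>{..n}. add_pow R (p choose Suc k) (x [^] Suc k \<otimes> y [^] (p - Suc k)))
       = (\<Oplus>k\<in>{..n}. if k = n then x [^] p else \<zero>)"
      using xy z by (intro finsum_cong') (auto simp: n simp del: nat_pow_Suc binomial_Suc_Suc)
    also have "\<dots> = x [^] p"
      using xy finsum_singleton[of n "{..n}" "\<lambda>_. x [^] p"] by (simp add: eq_commute[of n])
    finally show ?thesis
      unfolding binomial_expansion[OF xy] using xy
      by (subst (1) n, subst finsum_Suc2) (auto simp: n simp del: nat_pow_Suc)
  qed
  show ?case
    using Suc by (simp add: nat_pow_pow[symmetric] step mult.commute)
qed simp

lemma (in cring) frobenius_finsum: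
  assumes p: "Factorial_Ring.prime (p::nat)" and char: "add_pow R p \<one> = \<zero>"
    and f: "f \<in> A \<rightarrow> carrier R"
  shows "(\<Oplus>k\<in>A. f k) [^] (p ^ i) = (\<Oplus>k\<in>A. f k [^] (p ^ i))"
  using f
proof (induction A rule: infinite_finite_induct)
  case (insert x A)
  then have "f x \<in> carrier R" "f \<in> A \<rightarrow> carrier R" "(\<lambda>k. f k [^] (p ^ i)) \<in> A \<rightarrow> carrier R"
    by auto
  with insert show ?case by (simp add: frobenius_add[OF p char])
qed (use prime_gt_0_nat[OF p] in \<open>auto simp: nat_pow_zero\<close>)

text \<open>With the factor \<open>1/2\<close> this turns a product into three squarings.\<close>

lemma (in cring) polarization:
  assumes "x \<in> carrier R" "y \<in> carrier R"
  shows "(x \<oplus> y) \<otimes> (x \<oplus> y) \<ominus> x \<otimes> x \<ominus> y \<otimes> y = x \<otimes> y \<oplus> x \<otimes> y"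
proof -
  have cancel: "(a \<oplus> c \<oplus> b) \<ominus> a \<ominus> b = c" if "a \<in> carrier R" "b \<in> carrier R" "c \<in> carrier R" for a b c
    using that by algebra
  have "(x \<oplus> y) \<otimes> (x \<oplus> y) = x \<otimes> x \<oplus> (x \<otimes> y \<oplus> x \<otimes> y) \<oplus> y \<otimes> y"
    using assms by (simp add: l_distr r_distr a_ac m_ac)
  then show ?thesis using assms by (simp add: cancel)
qed

text \<open>The terms are grouped by powers of \<open>u\<close> modulo \<open>u ^ 3 = 7\<close> for \<open>y = y\<^sub>1 u\<close> and \<open>z = z\<^sub>1 u\<^sup>2\<close>.\<close>

lemma (in cring) square_trinomial:
  assumes "x \<in> carrier R" "y \<in> carrier R" "z \<in> carrier R"
  shows "(x \<oplus> y \<oplus> z) \<otimes> (x \<oplus> y \<oplus> z) =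
    (x \<otimes> x \<oplus> (y \<otimes> z \<oplus> y \<otimes> z)) \<oplus> (x \<otimes> y \<oplus> x \<otimes> y \<oplus> z \<otimes> z)
     \<oplus> (y \<otimes> y \<oplus> (x \<otimes> z \<oplus> x \<otimes> z))"
  using assms by (simp add: l_distr r_distr m_ac a_ac)

text \<open>For a primitive cube root of unity \<open>w\<close>, the product of the two nontrivial conjugates of
  \<open>x + y + z\<close> under \<open>y \<mapsto> w y, z \<mapsto> w\<^sup>2 z\<close>; the result no longer involves \<open>w\<close>.\<close>

lemma (in cring) conjugate_product:
  assumes x: "x \<in> carrier R" "y \<in> carrier R" "z \<in> carrier R" "w \<in> carrier R"
    and w: "w \<oplus> w \<otimes> w = \<ominus> \<one>" "w \<otimes> w \<otimes> w = \<one>"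
  shows "(x \<oplus> w \<otimes> y \<oplus> w \<otimes> w \<otimes> z) \<otimes> (x \<oplus> w \<otimes> w \<otimes> y \<oplus> w \<otimes> z)
     = x \<otimes> x \<oplus> y \<otimes> y \<oplus> z \<otimes> z \<ominus> x \<otimes> y \<ominus> x \<otimes> z \<ominus> y \<otimes> z"
proof -
  have sw: "w \<otimes> c \<oplus> w \<otimes> w \<otimes> c = \<ominus> c" if "c \<in> carrier R" for c
    using that w x by (simp add: l_distr[symmetric] l_minus)
  have w4: "w \<otimes> (w \<otimes> (w \<otimes> c)) = c" if "c \<in> carrier R" for c
    using that w(2) x by (simp add: m_assoc[symmetric])
  have "(x \<oplus> w \<otimes> y \<oplus> w \<otimes> w \<otimes> z) \<otimes> (x \<oplus> w \<otimes> w \<otimes> y \<oplus> w \<otimes> z)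
    = x \<otimes> x \<oplus> y \<otimes> y \<oplus> z \<otimes> z \<oplus> (w \<otimes> (x \<otimes> y) \<oplus> w \<otimes> w \<otimes> (x \<otimes> y))
    \<oplus> (w \<otimes> (x \<otimes> z) \<oplus> w \<otimes> w \<otimes> (x \<otimes> z)) \<oplus> (w \<otimes> (y \<otimes> z) \<oplus> w \<otimes> w \<otimes> (y \<otimes> z))"
    using x by (simp add: l_distr r_distr m_ac a_ac w4)
  then show ?thesis using x sw by (simp add: minus_eq)
qed

section \<open>Straight-line programs\<close>

lemma exec_append: "exec L (xs @ ys) rs = exec L ys (exec L xs rs)"
  by (induction xs arbitrary: rs) simp_all

lemma length_exec [simp]: "length (exec L xs rs) = length rs + length xs"
  by (induction xs arbitrary: rs) simp_all

lemma step_append: "wf_instr (length rs) ins \<Longrightarrow> step L (rs @ zs) ins = step L rs ins"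
  by (cases ins) (simp_all add: nth_append)

text \<open>If no instruction of a block refers to a register written by the block, the instructions act
  independently of one another.\<close>

lemma exec_parallel:
  assumes "\<forall>ins\<in>set xs. wf_instr (length rs) ins"
  shows "exec L xs rs = rs @ map (step L rs) xs"
proof -
  have "exec L xs (rs @ zs) = rs @ zs @ map (step L rs) xs" for zs
    using assms by (induction xs arbitrary: zs) (simp_all add: step_append)
  from this[of "[]"] show ?thesis by simp
qed

lemma wf_instr_mono: "wf_instr m ins \<Longrightarrow> m \<le> n \<Longrightarrow> wf_instr n ins"
  by (cases ins) auto

text \<open>Well-formedness of a block of instructions started with \<open>n\<close> registers.\<close>

definition wf_body :: "nat \<Rightarrow> instr list \<Rightarrow> bool" where
  "wf_body n xs \<longleftrightarrow> (\<forall>k < length xs. wf_instr (n + k) (xs ! k))"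

lemma wf_body_append: "wf_body n (xs @ ys) \<longleftrightarrow> wf_body n xs \<and> wf_body (n + length xs) ys"
proof -
  have split: "(\<forall>k < a + b. P k) \<longleftrightarrow> (\<forall>k < a. P k) \<and> (\<forall>k < b. P (a + k))"
    for a b :: nat and P
  proof (intro iffI conjI allI impI)
    fix k assume P: "(\<forall>k < a. P k) \<and> (\<forall>k < b. P (a + k))" and k: "k < a + b"
    show "P k"
    proof (cases "k < a")
      case False
      then obtain j where "k = a + j" using le_Suc_ex not_less by blast
      with P k show ?thesis by simp
    qed (use P in simp)
  qed simp_all
  show ?thesis
    unfolding wf_body_def length_append split by (simp add: nth_append add.assoc)
qed

lemma wf_body_parallel: "\<forall>ins\<in>set xs. wf_instr n ins \<Longrightarrow> wf_body n xs"
  unfolding wf_body_def by (meson le_add1 nth_mem wf_instr_mono)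

text \<open>Linear expressions with rational scalars over registers of type \<open>'r\<close>.  Subtraction is written
  with the scalar \<open>-1\<close>.\<close>

datatype 'r lexp =
    Reg 'r
  | Plus "'r lexp" "'r lexp"
  | Times rat "'r lexp"

text \<open>The value of an expression when \<open>\<rho>\<close> gives the contents of the registers.\<close>

primrec ev :: "('a, 'm) ring_scheme \<Rightarrow> ('r \<Rightarrow> 'a) \<Rightarrow> 'r lexp \<Rightarrow> 'a" where
  "ev L \<rho> (Reg i) = \<rho> i"
| "ev L \<rho> (Plus e f) = ev L \<rho> e \<oplus>\<^bsub>L\<^esub> ev L \<rho> f"
| "ev L \<rho> (Times r e) = rat_in L r \<otimes>\<^bsub>L\<^esub> ev L \<rho> e"

primrec scalars :: "'r lexp \<Rightarrow> rat set" where
  "scalars (Reg i) = {}"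
| "scalars (Plus e f) = scalars e \<union> scalars f"
| "scalars (Times r e) = insert r (scalars e)"

text \<open>The expression refers to the registers below \<open>n\<close> only, and its scalars are small.\<close>

definition wf_lexp :: "nat \<Rightarrow> nat lexp \<Rightarrow> bool" where
  "wf_lexp n e \<longleftrightarrow> set_lexp e \<subseteq> {..<n} \<and> (\<forall>r \<in> scalars e. small_rat r)"

lemma ev_cong: "(\<And>i. i \<in> set_lexp e \<Longrightarrow> \<rho> i = \<sigma> i) \<Longrightarrow> ev L \<rho> e = ev L \<sigma> e"
  by (induction e) simp_all

lemma ev_map_lexp: "ev L \<rho> (map_lexp f e) = ev L (\<rho> \<circ> f) e"
  by (induction e) simp_all

lemma scalars_map_lexp [simp]: "scalars (map_lexp f e) = scalars e"
  by (induction e) simp_all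

text \<open>\<open>compile n e\<close> computes \<open>e\<close> by additions and scalings appended to \<open>n\<close> registers; it returns the
  new instructions and the register that holds the value.  Common subexpressions are not shared,
  since linear operations are not counted.\<close>

primrec compile :: "nat \<Rightarrow> nat lexp \<Rightarrow> instr list \<times> nat" where
  "compile n (Reg i) = ([], i)"
| "compile n (Plus e f) =
    (let (xs, i) = compile n e; (ys, j) = compile (n + length xs) f
     in (xs @ ys @ [Add i j], n + length xs + length ys))"
| "compile n (Times r e) =
    (let (xs, i) = compile n e in (xs @ [Scale r i], n + length xs))"

primrec compile_list :: "nat \<Rightarrow> nat lexp list \<Rightarrow> instr list \<times> nat list" where
  "compile_list n [] = ([], [])"
| "compile_list n (e # es) =
    (let (xs, i) = compile n e; (ys, is) = compile_list (n + length xs) es in (xs @ ys, i # is))"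

text \<open>Blocks that contribute nothing to the cost.\<close>

definition linear_body :: "instr list \<Rightarrow> bool" where
  "linear_body xs \<longleftrightarrow> (\<forall>ins \<in> set xs. \<not> is_Mul ins \<and> \<not> is_Sqr ins)"

lemma wf_lexp_mono: "wf_lexp m e \<Longrightarrow> m \<le> n \<Longrightarrow> wf_lexp n e"
  by (force simp: wf_lexp_def)

lemma compile_correct:
  assumes "compile (length rs) e = (xs, i)" "wf_lexp (length rs) e"
  shows "wf_body (length rs) xs \<and> linear_body xs \<and> i < length rs + length xs \<and>
    (\<exists>zs. exec L xs rs = rs @ zs \<and> (rs @ zs) ! i = ev L ((!) rs) e)"
  using assms
proof (induction e arbitrary: rs xs i)
  case (Reg j)
  then show ?case by (simp add: wf_body_def linear_body_def wf_lexp_def)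
next
  case (Plus e f)
  obtain xs' i' where 1: "compile (length rs) e = (xs', i')" by fastforce
  obtain ys j where 2: "compile (length rs + length xs') f = (ys, j)" by fastforce
  have wf: "wf_lexp (length rs) e" "wf_lexp (length rs) f"
    using Plus.prems(2) by (auto simp: wf_lexp_def)
  from Plus.IH(1)[OF 1 wf(1)] obtain zs where e: "wf_body (length rs) xs'" "linear_body xs'"
    "i' < length rs + length xs'" "exec L xs' rs = rs @ zs" "(rs @ zs) ! i' = ev L ((!) rs) e"
    by blast
  have len: "length (rs @ zs) = length rs + length xs'" unfolding e(4)[symmetric] by simp
  have wf': "wf_lexp (length (rs @ zs)) f" using wf_lexp_mono[OF wf(2)] by simp
  from Plus.IH(2)[of "rs @ zs", OF _ wf', unfolded len, OF 2] obtain zs' where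
    f: "wf_body (length rs + length xs') ys" "linear_body ys"
    "j < length rs + length xs' + length ys" "exec L ys (rs @ zs) = (rs @ zs) @ zs'"
    "((rs @ zs) @ zs') ! j = ev L ((!) (rs @ zs)) f" by blast
  have len': "length zs = length xs'" "length zs' = length ys"
    using len arg_cong[OF f(4), of length] by simp_all
  have ef: "ev L ((!) (rs @ zs)) f = ev L ((!) rs) f"
    using wf(2) by (intro ev_cong) (auto simp: wf_lexp_def nth_append)
  have xs: "xs = xs' @ ys @ [Add i' j]" "i = length rs + length xs' + length ys"
    using Plus.prems(1) 1 2 by simp_all
  have "(rs @ zs @ ws) ! i' = ev L ((!) rs) e" for ws
    using nth_append[of "rs @ zs" ws i'] e(3,5) len by simp
  then have "exec L xs rs = rs @ zs @ zs' @ [ev L ((!) rs) (Plus e f)]"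
    using f(5) by (simp add: xs exec_append e(4) f(4) ef)
  moreover have "(rs @ zs @ zs' @ [a]) ! i = a" for a
    using len' by (simp add: xs nth_append)
  moreover have "wf_body (length rs) xs" "linear_body xs"
    using e(1-3) f(1-3)
    by (auto simp: xs wf_body_append linear_body_def wf_body_def[of _ "[_]"])
  ultimately show ?case by (auto simp: xs)
next
  case (Times r e)
  obtain xs' i' where 1: "compile (length rs) e = (xs', i')" by fastforce
  have wf: "wf_lexp (length rs) e" "small_rat r"
    using Times.prems(2) by (auto simp: wf_lexp_def)
  from Times.IH[OF 1 wf(1)] obtain zs where e: "wf_body (length rs) xs'" "linear_body xs'"
    "i' < length rs + length xs'" "exec L xs' rs = rs @ zs" "(rs @ zs) ! i' = ev L ((!) rs) e"
    by blast
  have len: "length zs = length xs'" using arg_cong[OF e(4), of length] by simp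
  have xs: "xs = xs' @ [Scale r i']" "i = length rs + length xs'"
    using Times.prems(1) 1 by simp_all
  show ?case
    using e wf len unfolding xs
    by (simp add: exec_append wf_body_append linear_body_def wf_body_def[of _ "[_]"] nth_append)
qed

lemma compile_list_correct:
  assumes "compile_list (length rs) es = (xs, is)" "\<forall>e\<in>set es. wf_lexp (length rs) e"
  shows "wf_body (length rs) xs \<and> linear_body xs \<and>
    (\<forall>i\<in>set is. i < length rs + length xs) \<and>
    (\<exists>zs. exec L xs rs = rs @ zs \<and> map ((!) (rs @ zs)) is = map (ev L ((!) rs)) es)"
  using assms
proof (induction es arbitrary: rs xs "is")
  case Nil
  then show ?case by (simp add: wf_body_def linear_body_def)
next
  case (Cons e es)
  obtain xs' i' where 1: "compile (length rs) e = (xs', i')" by fastforce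
  obtain ys js where 2: "compile_list (length rs + length xs') es = (ys, js)" by fastforce
  have wf: "wf_lexp (length rs) e" "\<forall>e\<in>set es. wf_lexp (length rs) e"
    using Cons.prems(2) by auto
  from compile_correct[OF 1 wf(1), of L] obtain zs where
    e: "wf_body (length rs) xs'" "linear_body xs'"
    "i' < length rs + length xs'" "exec L xs' rs = rs @ zs" "(rs @ zs) ! i' = ev L ((!) rs) e"
    by blast
  have len: "length (rs @ zs) = length rs + length xs'" unfolding e(4)[symmetric] by simp
  have wf': "\<forall>e\<in>set es. wf_lexp (length (rs @ zs)) e" using wf_lexp_mono wf(2) by fastforce
  from Cons.IH[of "rs @ zs", OF _ wf', unfolded len, OF 2] obtain zs' where
    f: "wf_body (length rs + length xs') ys" "linear_body ys"
    "\<forall>i\<in>set js. i < length rs + length xs' + length ys" "exec L ys (rs @ zs) = (rs @ zs) @ zs'"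
    "map ((!) ((rs @ zs) @ zs')) js = map (ev L ((!) (rs @ zs))) es" by blast
  have len': "length zs = length xs'" "length zs' = length ys"
    using len arg_cong[OF f(4), of length] by simp_all
  have ef: "map (ev L ((!) (rs @ zs))) es = map (ev L ((!) rs)) es"
    using wf(2) by (intro map_cong refl ev_cong) (auto simp: wf_lexp_def nth_append)
  have xs: "xs = xs' @ ys" "is = i' # js"
    using Cons.prems(1) 1 2 by simp_all
  have "(rs @ zs @ ws) ! i' = ev L ((!) rs) e" for ws
    using nth_append[of "rs @ zs" ws i'] e(3,5) len by simp
  then have "map ((!) (rs @ zs @ zs')) is = map (ev L ((!) rs)) (e # es)"
    using f(5) ef by (simp add: xs)
  moreover have "exec L xs rs = rs @ zs @ zs'"
    by (simp add: xs exec_append e(4) f(4))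
  moreover have "wf_body (length rs) xs" "linear_body xs" "\<forall>i\<in>set is. i < length rs + length xs"
    using e(1-3) f(1-3) by (auto simp: xs wf_body_append linear_body_def)
  ultimately show ?case by blast
qed

text \<open>\<open>quad_slp es fs\<close> evaluates the linear forms \<open>es\<close> on the nine inputs, squares each of the values,
  and returns the values of the linear forms \<open>fs\<close> on these squares.  Here register \<open>i\<close> of \<open>fs\<close> means
  the square number \<open>i\<close>, which the program stores in register \<open>n + i\<close>.\<close>

definition quad_slp :: "nat lexp list \<Rightarrow> nat lexp list \<Rightarrow> slp" where
  "quad_slp es fs =
    (let (xs, is) = compile_list 9 es; n = 9 + length xs;
         (ys, os) = compile_list (n + length es) (map (map_lexp ((+) n)) fs)
     in SLP 0 (xs @ map Sqr is @ ys) os)"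

text \<open>A family of nine quadratic forms costs as many squarings as the squares of linear forms that it
  is combined from, and no multiplication.\<close>

lemma quad_slp_correct:
  assumes es: "\<forall>e\<in>set es. wf_lexp 9 e" and fs: "\<forall>f\<in>set fs. wf_lexp (length es) f"
    and "length fs = 9"
  shows "wf_slp (quad_slp es fs)" "mults (quad_slp es fs) = 0"
    "squarings (quad_slp es fs) = length es" "num_consts (quad_slp es fs) = 0"
    "length c = 9 \<Longrightarrow> run L (quad_slp es fs) [] c =
      map (ev L (\<lambda>i. ev L ((!) c) (es ! i) \<otimes>\<^bsub>L\<^esub> ev L ((!) c) (es ! i))) fs"
proof -
  obtain xs "is" where 1: "compile_list 9 es = (xs, is)" by fastforce
  let ?n = "9 + length xs"
  let ?fs = "map (map_lexp ((+) ?n)) fs"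
  obtain ys os where 2: "compile_list (?n + length es) ?fs = (ys, os)" by fastforce
  have P: "quad_slp es fs = SLP 0 (xs @ map Sqr is @ ys) os"
    unfolding quad_slp_def 1 by (simp add: 2)
  have wf2: "\<forall>f\<in>set ?fs. wf_lexp (?n + length es) f"
    using fs by (force simp: wf_lexp_def lexp.set_map)
  have *: "wf_body 9 (xs @ map Sqr is @ ys) \<and> linear_body xs \<and> linear_body ys \<and>
     length is = length es \<and> length os = 9 \<and> (\<forall>i\<in>set os. i < 9 + length (xs @ map Sqr is @ ys)) \<and>
     map (\<lambda>i. exec L (xs @ map Sqr is @ ys) c ! i) os = 
      map (ev L (\<lambda>i. ev L ((!) c) (es ! i) \<otimes>\<^bsub>L\<^esub> ev L ((!) c) (es ! i))) fs"
    if c: "length c = 9" for c :: "'a list" and L :: "('a, 'm) ring_scheme"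
  proof -
    from compile_list_correct[of c, unfolded c, OF 1 es, of L] obtain zs where
      e: "wf_body 9 xs" "linear_body xs" "\<forall>i\<in>set is. i < 9 + length xs"
      "exec L xs c = c @ zs" "map ((!) (c @ zs)) is = map (ev L ((!) c)) es"
      by blast
    have len: "length zs = length xs" "length is = length es"
      using arg_cong[OF e(4), of length] arg_cong[OF e(5), of length] by simp_all
    let ?sq = "map (step L (c @ zs)) (map Sqr is)"
    have sq: "exec L (map Sqr is) (c @ zs) = c @ zs @ ?sq"
      using e(3) c len by (subst exec_parallel) auto
    let ?rs = "c @ zs @ ?sq"
    have lrs: "length ?rs = ?n + length es" using c len by simp
    from compile_list_correct[of ?rs, unfolded lrs, OF 2 wf2, of L] obtain ws where
      f: "wf_body (?n + length es) ys" "linear_body ys"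
      "\<forall>i\<in>set os. i < ?n + length es + length ys" "exec L ys ?rs = ?rs @ ws"
      "map ((!) (?rs @ ws)) os = map (ev L ((!) ?rs)) ?fs"
      by blast
    have sqv: "?rs ! (?n + i) = ev L ((!) c) (es ! i) \<otimes>\<^bsub>L\<^esub> ev L ((!) c) (es ! i)"
      if "i < length es" for i
    proof -
      have "(c @ zs) ! (is ! i) = ev L ((!) c) (es ! i)"
        using arg_cong[OF e(5), of "\<lambda>l. l ! i"] that len by simp
      then show ?thesis using that len c by (simp add: nth_append)
    qed
    have res: "map (ev L ((!) ?rs)) ?fs =
        map (ev L (\<lambda>i. ev L ((!) c) (es ! i) \<otimes>\<^bsub>L\<^esub> ev L ((!) c) (es ! i))) fs"
    proof -
      have "ev L ((!) ?rs \<circ> (+) ?n) f =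
          ev L (\<lambda>i. ev L ((!) c) (es ! i) \<otimes>\<^bsub>L\<^esub> ev L ((!) c) (es ! i)) f" if "f \<in> set fs" for f
      proof (rule ev_cong)
        fix i assume "i \<in> set_lexp f"
        with fs that have "i < length es" by (auto simp: wf_lexp_def)
        from sqv[OF this] show "((!) ?rs \<circ> (+) ?n) i =
            ev L ((!) c) (es ! i) \<otimes>\<^bsub>L\<^esub> ev L ((!) c) (es ! i)" by simp
      qed
      then show ?thesis by (simp add: ev_map_lexp)
    qed
    have "wf_body ?n (map Sqr is)"
      using e(3) by (intro wf_body_parallel) auto
    moreover have "length os = 9"
      using arg_cong[OF f(5), of length] \<open>length fs = 9\<close> by simp
    moreover have "map (\<lambda>i. exec L (xs @ map Sqr is @ ys) c ! i) os =
        map (ev L (\<lambda>i. ev L ((!) c) (es ! i) \<otimes>\<^bsub>L\<^esub> ev L ((!) c) (es ! i))) fs"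
      using f(5) unfolding res by (simp only: exec_append e(4) sq f(4))
    ultimately show ?thesis
      using e(1-3) f(1-3) len(2) by (simp add: wf_body_append add.assoc)
  qed
  have count: "length (filter is_Mul zs) = 0" "length (filter is_Sqr zs) = 0" 
    if "linear_body zs" for zs
    using that by (auto simp: linear_body_def filter_empty_conv)
  have W: "wf_body 9 (xs @ map Sqr is @ ys)" "linear_body xs" "linear_body ys"
      "length is = length es" "length os = 9" "\<forall>i\<in>set os. i < 9 + length (xs @ map Sqr is @ ys)"
    \<comment> \<open>These facts do not depend on the input; any list of length \<open>9\<close> serves as a witness.\<close>
    using *[of "replicate 9 undefined" L] by auto
  show "wf_slp (quad_slp es fs)" using W
    unfolding P wf_slp_def wf_body_def by simp
  show "mults (quad_slp es fs) = 0" "squarings (quad_slp es fs) = length es"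
    using W count unfolding P mults_def squarings_def by (simp_all add: filter_map comp_def)
  show "num_consts (quad_slp es fs) = 0" unfolding P by simp
  show "run L (quad_slp es fs) [] c =
      map (ev L (\<lambda>i. ev L ((!) c) (es ! i) \<otimes>\<^bsub>L\<^esub> ev L ((!) c) (es ! i))) fs" if "length c = 9"
    using *[OF that, of L] unfolding P run_def by simp
qed

text \<open>\<open>scale_slp ks os\<close> multiplies each of the coordinates listed in \<open>ks\<close> by a constant of its own; \<open>os\<close>
  selects the outputs.  With \<open>l\<close> the length of \<open>ks\<close>, the constants are in the registers from \<open>9\<close>
  and the products in the registers from \<open>9 + l\<close>.\<close>

definition scale_slp :: "nat list \<Rightarrow> nat list \<Rightarrow> slp" where
  "scale_slp ks os = SLP (length ks) (map (\<lambda>j. Mul (ks ! j) (9 + j)) [0..<length ks]) os"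

lemma scale_slp_correct:
  assumes "\<forall>k\<in>set ks. k < 9" "length os = 9" "\<forall>i\<in>set os. i < 9 + 2 * length ks"
  shows "wf_slp (scale_slp ks os)" "mults (scale_slp ks os) = length ks"
    "squarings (scale_slp ks os) = 0" "num_consts (scale_slp ks os) = length ks"
    "length c = 9 \<Longrightarrow> length ds = length ks \<Longrightarrow> run L (scale_slp ks os) ds c =
      map ((!) (c @ ds @ map (\<lambda>j. c ! (ks ! j) \<otimes>\<^bsub>L\<^esub> ds ! j) [0..<length ks])) os"
proof -
  let ?body = "map (\<lambda>j. Mul (ks ! j) (9 + j)) [0..<length ks]"
  have ops: "\<forall>ins\<in>set ?body. wf_instr (9 + length ks) ins"
    using assms(1) by (auto simp: trans_less_add1)
  then show "wf_slp (scale_slp ks os)"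
    using assms wf_body_parallel[OF ops] by (auto simp: wf_slp_def scale_slp_def wf_body_def)
  show "mults (scale_slp ks os) = length ks" "squarings (scale_slp ks os) = 0"
    "num_consts (scale_slp ks os) = length ks"
    by (simp_all add: mults_def squarings_def scale_slp_def filter_map comp_def)
  assume len: "length c = 9" "length ds = length ks"
  have "exec L ?body (c @ ds) = (c @ ds) @ map (step L (c @ ds)) ?body"
    using ops len by (intro exec_parallel) simp
  also have "map (step L (c @ ds)) ?body = map (\<lambda>j. c ! (ks ! j) \<otimes>\<^bsub>L\<^esub> ds ! j) [0..<length ks]"
    using assms(1) len by (auto simp: nth_append)
  finally show "run L (scale_slp ks os) ds c =
      map ((!) (c @ ds @ map (\<lambda>j. c ! (ks ! j) \<otimes>\<^bsub>L\<^esub> ds ! j) [0..<length ks])) os"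
    by (simp add: run_def scale_slp_def)
qed

text \<open>The coordinates \<open>1, ..., 8\<close> are scaled (the product for coordinate \<open>s\<close> is in register
  \<open>16 + s\<close>), and the product for coordinate \<open>m r mod 9\<close> becomes coordinate \<open>m\<close> of the result.\<close>

definition frob_slp :: "nat \<Rightarrow> slp" where
  "frob_slp r = scale_slp [1..<9] (map (\<lambda>m. let s = m * r mod 9 in if s = 0 then 0 else 16 + s) [0..<9])"

text \<open>The coordinates of \<open>1, u, u\<^sup>2\<close> (positions \<open>0, 3, 6\<close>) are copied; the other six are scaled,
  with constants in the registers \<open>9, ..., 14\<close> and products in \<open>15, ..., 20\<close>.\<close>

definition omega_slp :: slp where
  "omega_slp = scale_slp [1,2,4,5,7,8] [0,15,16,3,17,18,6,19,20]"

section \<open>Coordinates in the tower\<close>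

text \<open>A fixed instance of the tower, with \<open>p > 3\<close> and \<open>p \<equiv> 1 (mod 3)\<close>.\<close>

locale cubic_tower_field = field L for L :: "('a, 'm) ring_scheme" (structure) +
  fixes p :: nat and K :: "'a set" and u v :: 'a
  assumes prime_p: "Factorial_Ring.prime p" and p_gt_3: "p > 3" and p_mod_3: "[p = 1] (mod 3)"
    and tower: "cubic_tower p L K u v"
begin

definition seven :: 'a where "seven = add_pow L (7::nat) \<one>"

lemma order_L: "order L = p ^ 9" and K_subfield: "subfield K L" and card_K: "card K = p"
  and u_closed [simp]: "u \<in> carrier L" and v_closed [simp]: "v \<in> carrier L"
  and u_cubed: "u [^] (3::nat) = seven" and v_cubed: "v [^] (3::nat) = u"
  and tower_eq: "simple_extension (simple_extension K u) v = carrier L"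
  using tower unfolding cubic_tower_def seven_def by auto

lemma p_pos: "p > 0" using p_gt_3 by simp

lemma finite_L: "finite (carrier L)"
  using order_L p_pos unfolding order_def by (metis card.infinite not_gr0 zero_less_power)

lemma K_subring: "subring K L" using K_subfield by (rule subfieldE(1))
lemma K_subset: "K \<subseteq> carrier L" using subringE(1)[OF K_subring] .
lemma finite_K: "finite K" using K_subset finite_L by (rule finite_subset)
lemma K_closed [simp]: "a \<in> K \<Longrightarrow> a \<in> carrier L" using K_subset by blast

lemma K_mult [simp]: "a \<in> K \<Longrightarrow> b \<in> K \<Longrightarrow> a \<otimes> b \<in> K" by (rule subringE(6)[OF K_subring])
lemma K_add [simp]: "a \<in> K \<Longrightarrow> b \<in> K \<Longrightarrow> a \<oplus> b \<in> K" by (rule subringE(7)[OF K_subring])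
lemma K_minus [simp]: "a \<in> K \<Longrightarrow> \<ominus> a \<in> K" by (rule subringE(5)[OF K_subring])
lemma K_zero [simp]: "\<zero> \<in> K" and K_one [simp]: "\<one> \<in> K"
  using subringE(2,3)[OF K_subring] by auto
lemma K_pow [simp]: "a \<in> K \<Longrightarrow> a [^] (n::nat) \<in> K" by (induction n) simp_all
lemma K_add_pow [simp]: "a \<in> K \<Longrightarrow> add_pow L (n::nat) a \<in> K" by (induction n) simp_all
lemma K_inv [simp]: "a \<in> K \<Longrightarrow> a \<noteq> \<zero> \<Longrightarrow> inv a \<in> K"
  using subfield_m_inv(1)[OF K_subfield] by simp
lemma seven_K [simp]: "seven \<in> K" unfolding seven_def by simp

lemma char_p: "add_pow L p \<one> = \<zero>"
proof -
  interpret K: ring "L\<lparr>carrier := K\<rparr>" by (rule subring_is_ring[OF K_subring])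
  have "add_pow (L\<lparr>carrier := K\<rparr>) p \<one> = \<zero>"
    using K.add.pow_order_eq_1[of \<one>] by (simp add: order_def card_K)
  then show ?thesis by (simp add: add_pow_def nat_pow_def)
qed

lemma K_fermat: assumes "a \<in> K" "a \<noteq> \<zero>" shows "a [^] (p - 1) = \<one>"
proof -
  interpret K: field "L\<lparr>carrier := K\<rparr>" by (rule subfield_iff(2)[OF K_subfield])
  interpret M: group "Multiplicative_Group.mult_of (L\<lparr>carrier := K\<rparr>)" by (rule K.field_mult_group)
  have "order (Multiplicative_Group.mult_of (L\<lparr>carrier := K\<rparr>)) = p - 1"
    using K.order_mult_of finite_K by (simp add: order_def card_K)
  with M.pow_order_eq_1[of a] assms show ?thesis
    by (simp add: nat_pow_mult_of) (simp add: nat_pow_def)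
qed

lemma K_frobenius: assumes "a \<in> K" shows "a [^] (p ^ i) = a"
proof (induction i)
  case (Suc i)
  have "a [^] p = a"
  proof (cases "a = \<zero>")
    case False
    have "a [^] p = a [^] (p - 1) \<otimes> a" using p_pos by (metis Suc_diff_1 nat_pow_Suc)
    then show ?thesis using K_fermat[OF assms False] assms by simp
  qed (use p_pos in \<open>simp add: nat_pow_zero\<close>)
  with Suc assms show ?case
    by (simp add: nat_pow_pow[symmetric])
qed (use assms in simp)

lemma v_pow_9: "v [^] (9::nat) = seven"
proof -
  have "v [^] (9::nat) = (v [^] (3::nat)) [^] (3::nat)" by (simp add: nat_pow_pow)
  then show ?thesis by (simp add: u_cubed v_cubed)
qed

text \<open>Since \<open>v\<^sup>9 = 7\<close>, a power of \<open>v\<close> is a power of \<open>7\<close> times one of \<open>1, v, ..., v\<^sup>8\<close>.\<close>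

lemma v_pow_reduce: "v [^] (n::nat) = seven [^] (n div 9) \<otimes> v [^] (n mod 9)"
proof -
  have "v [^] n = v [^] (9 * (n div 9) + n mod 9)" by simp
  also have "\<dots> = (v [^] (9::nat)) [^] (n div 9) \<otimes> v [^] (n mod 9)"
    by (simp only: nat_pow_mult[symmetric] nat_pow_pow v_closed)
  finally show ?thesis unfolding v_pow_9 .
qed

text \<open>The possible coordinate vectors.\<close>

definition vecs :: "'a list set" where "vecs = {c. length c = 9 \<and> set c \<subseteq> K}"

lemma vecsD: "c \<in> vecs \<Longrightarrow> length c = 9" "c \<in> vecs \<Longrightarrow> k < 9 \<Longrightarrow> c ! k \<in> K"
  by (auto simp: vecs_def)

text \<open>The basis element \<open>u\<^sup>i v\<^sup>j\<close> is \<open>v ^ (3 i + j)\<close>, so position \<open>k\<close> of a coordinate vector belongs to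
  \<open>v ^ k\<close>.\<close>

lemma from_coords_expand:
  assumes "\<And>k. k < 9 \<Longrightarrow> c ! k \<in> carrier L"
  shows "from_coords L u v c = (\<Oplus>k\<in>{..<9}. c ! k \<otimes> v [^] k)"
proof -
  have uv: "u [^] i \<otimes> v [^] j = v [^] (3 * i + j)" for i j :: nat
    by (simp add: v_cubed[symmetric] nat_pow_pow nat_pow_mult)
  have "{..<9::nat} = {0,1,2,3,4,5,6,7,8}" "{..<3::nat} = {0,1,2}" by auto
  then show ?thesis
    unfolding from_coords_def uv using assms by (simp add: a_assoc a_comm a_lcomm)
qed

lemma from_coords_closed: "c \<in> vecs \<Longrightarrow> from_coords L u v c \<in> carrier L"
  by (subst from_coords_expand) (auto simp: vecsD Pi_def intro!: finsum_closed)

text \<open>The elements that have coordinates.\<close>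

definition vspan where "vspan = from_coords L u v ` vecs"

lemma vspanI:
  fixes g :: "nat \<Rightarrow> 'a"
  assumes "\<And>k. k < 9 \<Longrightarrow> g k \<in> K" shows "(\<Oplus>k\<in>{..<9}. g k \<otimes> v [^] k) \<in> vspan"
proof -
  have "map g [0..<9] \<in> vecs" using assms by (auto simp: vecs_def)
  moreover have "from_coords L u v (map g [0..<9]) = (\<Oplus>k\<in>{..<9}. g k \<otimes> v [^] k)"
    using assms by (subst from_coords_expand) (auto intro!: finsum_cong')
  ultimately show ?thesis unfolding vspan_def by (metis image_eqI)
qed

lemma vspanE:
  assumes "a \<in> vspan"
  obtains g :: "nat \<Rightarrow> 'a" where "\<And>k. k < 9 \<Longrightarrow> g k \<in> K" "a = (\<Oplus>k\<in>{..<9}. g k \<otimes> v [^] k)"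
proof -
  from assms obtain c where "c \<in> vecs" "a = from_coords L u v c" unfolding vspan_def by blast
  then show thesis using that[of "(!) c"] by (simp add: vecsD from_coords_expand)
qed

lemma vspan_add: assumes "a \<in> vspan" "b \<in> vspan" shows "a \<oplus> b \<in> vspan"
proof -
  obtain g :: "nat \<Rightarrow> 'a" where g: "\<And>k. k < 9 \<Longrightarrow> g k \<in> K" "a = (\<Oplus>k\<in>{..<9}. g k \<otimes> v [^] k)"
    using assms(1) vspanE by blast
  obtain h :: "nat \<Rightarrow> 'a" where h: "\<And>k. k < 9 \<Longrightarrow> h k \<in> K" "b = (\<Oplus>k\<in>{..<9}. h k \<otimes> v [^] k)"
    using assms(2) vspanE by blast
  have "a \<oplus> b = (\<Oplus>k\<in>{..<9}. g k \<otimes> v [^] k \<oplus> h k \<otimes> v [^] k)"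
    unfolding g(2) h(2) using g(1) h(1) by (subst finsum_addf) auto
  also have "\<dots> = (\<Oplus>k\<in>{..<9}. (g k \<oplus> h k) \<otimes> v [^] k)"
    using g(1) h(1) by (intro finsum_cong') (auto simp: l_distr)
  also have "\<dots> \<in> vspan" using g(1) h(1) by (intro vspanI) auto
  finally show ?thesis .
qed

lemma K_vspan: assumes "a \<in> K" shows "a \<in> vspan"
proof -
  have "(\<Oplus>k\<in>{..<9::nat}. (if k = 0 then a else \<zero>) \<otimes> v [^] k) = (\<Oplus>k\<in>{..<9::nat}. if 0 = k then a else \<zero>)"
    using assms by (auto intro!: finsum_cong')
  also have "\<dots> = a" using assms finsum_singleton[of "0::nat" "{..<9}" "\<lambda>_. a"] by simp
  finally have "a = (\<Oplus>k\<in>{..<9::nat}. (if k = 0 then a else \<zero>) \<otimes> v [^] k)" ..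
  also have "\<dots> \<in> vspan" using assms by (intro vspanI) auto
  finally show ?thesis .
qed

lemma vspan_mult_v: assumes "a \<in> vspan" shows "a \<otimes> v \<in> vspan"
proof -
  obtain g :: "nat \<Rightarrow> 'a" where g: "\<And>k. k < 9 \<Longrightarrow> g k \<in> K" "a = (\<Oplus>k\<in>{..<9}. g k \<otimes> v [^] k)"
    using assms vspanE by blast
  let ?h = "\<lambda>k. if k = 0 then g 8 \<otimes> seven else g (k - 1)"
  have 9: "{..<9::nat} = {..8}" "{..8::nat} = {..Suc 7}" by auto
  have "a \<otimes> v = (\<Oplus>k\<in>{..Suc 7}. g k \<otimes> v [^] Suc k)"
    unfolding g(2) 9 using g(1) by (subst finsum_ldistr) (auto simp: m_assoc intro!: finsum_cong')
  also have "\<dots> = (\<Oplus>k\<in>{..7}. g k \<otimes> v [^] Suc k) \<oplus> g 8 \<otimes> v [^] (9::nat)"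
    using g(1) by (subst finsum_Suc) (auto simp: a_comm simp del: nat_pow_Suc)
  also have "\<dots> = (\<Oplus>k\<in>{..Suc 7}. ?h k \<otimes> v [^] k)"
    using g(1) by (subst finsum_Suc2) (auto simp: v_pow_9 simp del: nat_pow_Suc)
  also have "\<dots> \<in> vspan" unfolding 9[symmetric] using g(1) by (intro vspanI) auto
  finally show ?thesis .
qed

lemma vspan_closed: "a \<in> vspan \<Longrightarrow> a \<in> carrier L"
  unfolding vspan_def using from_coords_closed by blast

lemma vspan_mult_u: assumes "a \<in> vspan" shows "a \<otimes> u \<in> vspan"
proof -
  have "a \<otimes> u = a \<otimes> v \<otimes> v \<otimes> v"
    using vspan_closed[OF assms] by (simp add: v_cubed[symmetric] numeral_3_eq_3 m_assoc)
  then show ?thesis using assms vspan_mult_v by simp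
qed

text \<open>Elements of a simple extension are built by the Horner scheme, so closure under addition and
  under multiplication by the generator suffices.\<close>

lemma vspan_eq: "vspan = carrier L"
proof
  have incl: "simple_extension K u \<subseteq> vspan"
  proof
    fix a assume "a \<in> simple_extension K u"
    then show "a \<in> vspan" by induction (auto intro: vspan_add vspan_mult_u K_vspan)
  qed
  have "a \<in> vspan" if "a \<in> simple_extension (simple_extension K u) v" for a
    using that by (induction rule: simple_extension.induct)
      (use incl K_vspan in \<open>auto intro: vspan_add vspan_mult_v\<close>)
  then show "carrier L \<subseteq> vspan" unfolding tower_eq by blast
qed (auto dest: vspan_closed)

text \<open>There are as many coordinate vectors as elements of \<open>L\<close>, so surjectivity implies injectivity.\<close>

lemma inj_from_coords: "inj_on (from_coords L u v) vecs"
proof (rule eq_card_imp_inj_on)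
  have "vecs = {c. set c \<subseteq> K \<and> length c = 9}" unfolding vecs_def by auto
  then show "finite vecs" "card (from_coords L u v ` vecs) = card vecs"
    using finite_K card_lists_length_eq[OF finite_K, of 9] finite_lists_length_eq[OF finite_K, of 9]
      vspan_eq order_L unfolding vspan_def by (simp_all add: order_def card_K)
qed

lemma coords_from_coords: "c \<in> vecs \<Longrightarrow> coords L K u v (from_coords L u v c) = c"
  unfolding coords_def using inj_from_coords
  by (intro the_equality) (auto simp: vecs_def inj_on_def)

lemma coords_obtain:
  assumes "a \<in> carrier L" obtains c where "c \<in> vecs" "a = from_coords L u v c"
  using assms vspan_eq unfolding vspan_def by blast

lemma v_nonzero: "v \<noteq> \<zero>"
proof
  assume v: "v = \<zero>"
  \<comment> \<open>If \<open>v = 0\<close>, the coordinate at position \<open>1\<close> is irrelevant, contradicting injectivity.\<close>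
  let ?e = "\<zero> # \<one> # replicate 7 \<zero>" and ?z = "replicate 9 \<zero>"
  have vecs: "?e \<in> vecs" "?z \<in> vecs" unfolding vecs_def by auto
  have "?e ! k \<otimes> v [^] k = ?z ! k \<otimes> v [^] k" if "k < 9" for k
    using vecsD(2)[OF vecs(1) that] vecsD(2)[OF vecs(2) that] by (cases k) (auto simp: v)
  then have "from_coords L u v ?e = from_coords L u v ?z"
    using vecsD(2)[OF vecs(1)] vecsD(2)[OF vecs(2)]
    by (simp only: from_coords_expand K_closed) (intro finsum_cong', auto)
  with inj_onD[OF inj_from_coords _ vecs] show False by (simp add: numeral_eq_Suc)
qed

lemma seven_nonzero: "seven \<noteq> \<zero>"
proof -
  have "v [^] n \<noteq> \<zero>" for n :: nat
    by (induction n) (auto simp: v_nonzero dest: integral)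
  then show ?thesis unfolding v_pow_9[symmetric] .
qed

end

section \<open>Frobenius maps\<close>

context cubic_tower_field
begin

text \<open>It suffices to verify a program on coordinate vectors.\<close>

lemma costs_from_coordsI:
  assumes "P \<in> Ps" "wf_slp P" "mults P \<le> x" "squarings P \<le> y" "length ks = num_consts P" "set ks \<subseteq> K"
    and "\<And>c. c \<in> vecs \<Longrightarrow> from_coords L u v c \<in> D \<Longrightarrow> run L P ks c \<in> vecs \<and> from_coords L u v (run L P ks c) = f (from_coords L u v c)"
    and "D \<subseteq> carrier L"
  shows "costs Ps L K u v D f x y"
  unfolding costs_def
proof (intro bexI[OF _ assms(1)] conjI exI[of _ ks] ballI assms(2-6))
  fix a assume "a \<in> D"
  then obtain c where c: "c \<in> vecs" "a = from_coords L u v c"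
    using coords_obtain assms(8) by blast
  with assms(7)[OF c(1)] \<open>a \<in> D\<close> show "run L P ks (coords L K u v a) = coords L K u v (f a)"
    by (metis coords_from_coords)
qed

text \<open>For \<open>q = p ^ i\<close>, the term \<open>c v ^ k\<close> is mapped to \<open>c v ^ (k q)\<close>, a multiple of \<open>v ^ (k q mod 9)\<close> by
  a power of \<open>7\<close>.  Hence coordinate \<open>m\<close> of the image comes from position \<open>m r mod 9\<close>, where \<open>r\<close> is
  the inverse of \<open>q\<close> modulo \<open>9\<close>.\<close>

lemma frobenius_from_coords:
  assumes c: "c \<in> vecs" and r: "r * p ^ i mod 9 = 1"
  shows "from_coords L u v c [^] (p ^ i) =
    (\<Oplus>m\<in>{..<9}. (c ! (m * r mod 9) \<otimes> seven [^] ((m * r mod 9) * p ^ i div 9)) \<otimes> v [^] m)"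
proof -
  let ?q = "p ^ i" and ?s = "\<lambda>m. m * r mod 9"
  let ?g = "\<lambda>k. (c ! k \<otimes> seven [^] (k * ?q div 9)) \<otimes> v [^] (k * ?q mod 9)"
  have inv: "?s m * ?q mod 9 = m" if "m < 9" for m
  proof -
    have "?s m * ?q mod 9 = m * (r * ?q) mod 9" by (simp add: mod_mult_left_eq mult.assoc)
    also have "\<dots> = m * (r * ?q mod 9) mod 9" by (simp only: mod_mult_right_eq)
    finally show ?thesis using that by (simp add: r)
  qed
  then have inj: "inj_on ?s {..<9}"
    by (intro inj_on_inverseI[of _ "\<lambda>k. k * ?q mod 9"]) auto
  then have img: "?s ` {..<9} = {..<9}"
    by (intro endo_inj_surj) auto
  have power: "(c ! k \<otimes> v [^] k) [^] ?q = ?g k" if "k < 9" for k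
    using vecsD(2)[OF c that]
    by (simp add: nat_pow_distrib K_frobenius nat_pow_pow v_pow_reduce[of "k * ?q"] m_assoc)
  have "from_coords L u v c [^] ?q = (\<Oplus>k\<in>{..<9}. (c ! k \<otimes> v [^] k) [^] ?q)"
    using c by (subst from_coords_expand)
      (auto simp: vecsD intro!: frobenius_finsum prime_p char_p)
  also have "\<dots> = (\<Oplus>k\<in>{..<9}. ?g k)"
    using c power by (intro finsum_cong') (auto simp: vecsD)
  also have "\<dots> = (\<Oplus>m\<in>{..<9}. ?g (?s m))"
    using c inj by (subst img[symmetric], subst finsum_reindex) (auto simp: vecsD)
  also have "\<dots> = (\<Oplus>m\<in>{..<9}. (c ! ?s m \<otimes> seven [^] (?s m * ?q div 9)) \<otimes> v [^] m)"
    using c inv by (intro finsum_cong') (auto simp: vecsD)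
  finally show ?thesis .
qed

lemma costs_scale_slp:
  fixes ds :: "'a list"
  assumes ks: "\<forall>k\<in>set ks. k < 9" "length os = 9" "\<forall>i\<in>set os. i < 9 + 2 * length ks"
    and P: "scale_slp ks os \<in> Ps" "length ks \<le> x"
    and r: "r * p ^ i mod 9 = 1"
    and ds: "length ds = length ks" "set ds \<subseteq> K"
    and run: "\<And>c m. c \<in> vecs \<Longrightarrow> m < 9 \<Longrightarrow>
      (c @ ds @ map (\<lambda>j. c ! (ks ! j) \<otimes> ds ! j) [0..<length ks]) ! (os ! m) =
      c ! (m * r mod 9) \<otimes> seven [^] ((m * r mod 9) * p ^ i div 9)"
  shows "costs Ps L K u v (carrier L) (frobenius L p i) x 0"
proof (rule costs_from_coordsI[OF P(1)])
  fix c assume c: "c \<in> vecs"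
  note slp = scale_slp_correct[OF ks]
  let ?r = "run L (scale_slp ks os) ds c"
  have nth: "?r ! m = c ! (m * r mod 9) \<otimes> seven [^] ((m * r mod 9) * p ^ i div 9)" if "m < 9" for m
    using slp(5)[of c ds L] run[OF c that] that ks(2) ds(1) vecsD(1)[OF c] by simp
  have len: "length ?r = 9" using slp(5)[of c ds L] ks(2) ds(1) vecsD(1)[OF c] by simp
  have "?r ! m \<in> K" if "m < 9" for m
    using nth[OF that] vecsD(2)[OF c] by simp
  then have vecs: "?r \<in> vecs" using len by (auto simp: vecs_def in_set_conv_nth)
  have "from_coords L u v ?r = frobenius L p i (from_coords L u v c)"
    unfolding frobenius_def frobenius_from_coords[OF c r] using vecsD(2)[OF vecs] vecsD(2)[OF c]
    by (subst from_coords_expand) (auto simp: nth intro!: finsum_cong')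
  with vecs show "?r \<in> vecs \<and> from_coords L u v ?r = frobenius L p i (from_coords L u v c)" ..
qed (use scale_slp_correct[OF ks] P ds in auto)

lemma less_9: "m < 9 \<Longrightarrow> m \<in> {0,1,2,3,4,5,6,7,8::nat}" by auto

lemma frob_costs:
  assumes r: "r \<in> {1, 4, 7}" "r * p ^ i mod 9 = 1" and "frob_slp r \<in> Ps"
  shows "costs Ps L K u v (carrier L) (frobenius L p i) 8 0"
proof (rule costs_scale_slp[where ds = "map (\<lambda>j. seven [^] (j * p ^ i div 9)) [1..<9]" and r = r])
  show "scale_slp [1..<9] (map (\<lambda>m. let s = m * r mod 9 in if s = 0 then 0 else 16 + s) [0..<9]) \<in> Ps"
    using assms(3) unfolding frob_slp_def .
next
  fix c m assume "c \<in> vecs" "m < (9::nat)"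
  let ?s = "m * r mod 9"
  let ?ds = "map (\<lambda>j. seven [^] (j * p ^ i div 9)) [1..<9]"
  have c: "length c = 9" "c ! ?s \<in> carrier L" using vecsD[OF \<open>c \<in> vecs\<close>] by auto
  show "(c @ ?ds @ map (\<lambda>j. c ! ([1..<9] ! j) \<otimes> ?ds ! j) [0..<length [1..<9]]) ! 
      (map (\<lambda>m. let s = m * r mod 9 in if s = 0 then 0 else 16 + s) [0..<9] ! m) =
      c ! ?s \<otimes> seven [^] (?s * p ^ i div 9)"
  proof (cases "?s = 0")
    case True
    then show ?thesis using c \<open>m < 9\<close> by (simp add: nth_append)
  next
    case False
    have "?s < 9" by simp
    then have "?s - 1 < 8" using False by linarith
    then show ?thesis using c \<open>m < 9\<close> False by (simp add: Let_def nth_append)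
  qed
next
  have "m * r mod 9 < 9" for m by simp
  then show "\<forall>i\<in>set (map (\<lambda>m. let s = m * r mod 9 in if s = 0 then 0 else 16 + s) [0..<9]).
      i < 9 + 2 * length [1..<9]"
    by (auto simp: Let_def)
qed (use r in auto)

lemma p_pow_mod_3: "p ^ i mod 3 = 1"
proof -
  have "p mod 3 = 1" using p_mod_3 by (simp add: cong_def)
  then show ?thesis using power_mod[of p 3 i] by simp
qed

lemma frob_costs_all:
  assumes "{frob_slp 1, frob_slp 4, frob_slp 7} \<subseteq> Ps"
  shows "costs Ps L K u v (carrier L) (frobenius L p i) 8 0"
proof -
  have "p ^ i mod 9 \<in> {1, 4, 7}" using p_pow_mod_3[of i] by simp presburger
  then obtain r where r: "r \<in> {1, 4, 7}" "r * (p ^ i mod 9) mod 9 = 1" by fastforce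
  then have "r * p ^ i mod 9 = 1" by (simp add: mod_mult_right_eq)
  with r(1) assms show ?thesis by (intro frob_costs[of r]) auto
qed

text \<open>The exponent \<open>3 t\<close> is the one in \<open>u ^ (p ^ i) = 7 ^ (3 t) u\<close>, so \<open>u\<close> is fixed by the maps
  considered here.\<close>

lemma cube_factor:
  assumes "i = 3 \<or> i = 6" obtains t where "p ^ i = 9 * t + 1" "(p - 1) dvd 3 * t"
proof -
  obtain s where s: "p = 3 * s + 1"
    using p_pow_mod_3[of 1] by (metis mult_div_mod_eq power_one_right)
  define t where "t = s * (3 * s ^ 2 + 3 * s + 1)"
  have 3: "p ^ 3 = 9 * t + 1" "(p - 1) dvd 3 * t"
    by (simp_all add: s t_def power3_eq_cube power2_eq_square algebra_simps)
  have "p ^ 6 = (p ^ 3) ^ 2" by (simp add: power_mult[symmetric])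
  also have "\<dots> = 9 * (t * (9 * t + 2)) + 1" unfolding 3(1) by (simp add: power2_eq_square algebra_simps)
  finally have "p ^ 6 = \<dots>" .
  moreover have "(p - 1) dvd 3 * (t * (9 * t + 2))" using 3(2) by (metis dvd_mult2 mult.assoc)
  ultimately show thesis using assms 3 that by blast
qed

lemma seven_pow_eq_one: "(p - 1) dvd n \<Longrightarrow> seven [^] n = \<one>"
  using K_fermat[OF seven_K seven_nonzero] by (auto simp: nat_pow_pow[symmetric] elim!: dvdE)

lemma omega_costs:
  assumes i: "i = 3 \<or> i = 6" and "omega_slp \<in> Ps"
  shows "costs Ps L K u v (carrier L) (frobenius L p i) 6 0"
proof -
  obtain t where t: "p ^ i = 9 * t + 1" "(p - 1) dvd 3 * t" using cube_factor[OF i] by blast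
  have one: "seven [^] (3 * p ^ i div 9) = \<one>" "seven [^] (6 * p ^ i div 9) = \<one>"
  proof -
    have "3 * p ^ i div 9 = 3 * t" "6 * p ^ i div 9 = 2 * (3 * t)" unfolding t(1) by presburger+
    then show "seven [^] (3 * p ^ i div 9) = \<one>" "seven [^] (6 * p ^ i div 9) = \<one>"
      using t(2) by (simp_all only: seven_pow_eq_one dvd_mult)
  qed
  let ?ks = "[1,2,4,5,7,8::nat]"
  let ?ds = "map (\<lambda>j. seven [^] (j * p ^ i div 9)) ?ks"
  show ?thesis
  proof (rule costs_scale_slp[where ds = "?ds" and r = 1])
    show "scale_slp ?ks [0,15,16,3,17,18,6,19,20] \<in> Ps" using assms(2) unfolding omega_slp_def .
    fix c m assume c: "c \<in> vecs" and m: "m < (9::nat)"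
    have "length c = 9" "\<And>k. k < 9 \<Longrightarrow> c ! k \<in> carrier L" using vecsD[OF c] by auto
    then show "(c @ ?ds @ map (\<lambda>j. c ! (?ks ! j) \<otimes> ?ds ! j) [0..<length ?ks]) ! 
        ([0,15,16,3,17,18,6,19,20] ! m) =
        c ! (m * 1 mod 9) \<otimes> seven [^] ((m * 1 mod 9) * p ^ i div 9)"
      using less_9[OF m] by (auto simp: nth_append one[simplified])
  qed (auto simp: t(1))
qed

end

section \<open>Inversion in the cyclotomic subgroup\<close>

text \<open>A triple \<open>(a, b, c)\<close> of linear expressions stands for the element \<open>a + b u + c u\<^sup>2\<close> of the cubic
  extension \<open>K[u]\<close>.\<close>

type_synonym 'r triple = "'r lexp \<times> 'r lexp \<times> 'r lexp"

abbreviation Minus :: "'r lexp \<Rightarrow> 'r lexp \<Rightarrow> 'r lexp" where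
  "Minus e f \<equiv> Plus e (Times (- 1) f)"

fun tplus :: "'r triple \<Rightarrow> 'r triple \<Rightarrow> 'r triple" where
  "tplus (a, b, c) (d, e, f) = (Plus a d, Plus b e, Plus c f)"

fun tminus :: "'r triple \<Rightarrow> 'r triple \<Rightarrow> 'r triple" where
  "tminus (a, b, c) (d, e, f) = (Minus a d, Minus b e, Minus c f)"

fun thalf :: "'r triple \<Rightarrow> 'r triple" where
  "thalf (a, b, c) = (Times (1/2) a, Times (1/2) b, Times (1/2) c)"

text \<open>Multiplication by \<open>u\<close>, using \<open>u\<^sup>3 = 7\<close>.\<close>

fun tshift :: "'r triple \<Rightarrow> 'r triple" where
  "tshift (a, b, c) = (Times 7 c, a, b)"

text \<open>The six linear forms whose squares determine the square of an element of \<open>K[u]\<close>.\<close>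

fun sq_forms :: "'r triple \<Rightarrow> 'r lexp list" where
  "sq_forms (a, b, c) = [a, b, c, Plus a b, Plus a c, Plus b c]"

text \<open>The square in \<open>K[u]\<close> recombined from the block of six squares in the registers from \<open>6 k\<close>, in
  the order of \<open>sq_forms\<close>; e.g. the difference of the squares \<open>5\<close>, \<open>1\<close> and \<open>2\<close> is \<open>2 b c\<close>.\<close>

definition sq_triple :: "nat \<Rightarrow> nat triple" where
  "sq_triple k = (let s = (\<lambda>i. Reg (6 * k + i)) in
    (Plus (s 0) (Times 7 (Minus (Minus (s 5) (s 1)) (s 2))),
     Plus (Minus (Minus (s 3) (s 0)) (s 1)) (Times 7 (s 2)),
     Plus (s 1) (Minus (Minus (s 4) (s 0)) (s 2))))"

text \<open>The product of two elements of \<open>K[u]\<close> whose squares are in blocks \<open>i\<close> and \<open>j\<close>, where block \<open>k\<close>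
  holds the square of their sum.\<close>

definition prod_triple :: "nat \<Rightarrow> nat \<Rightarrow> nat \<Rightarrow> nat triple" where
  "prod_triple k i j = thalf (tminus (tminus (sq_triple k) (sq_triple i)) (sq_triple j))"

text \<open>For \<open>\<alpha> = A + B v + C v\<^sup>2\<close>, the six elements of \<open>K[u]\<close> to be squared.  The coordinate of
  \<open>u\<^sup>i v\<^sup>j\<close> is in register \<open>3 i + j\<close>.\<close>

definition inv_inputs :: "nat triple list" where
  "inv_inputs = (let A = (Reg 0, Reg 3, Reg 6); B = (Reg 1, Reg 4, Reg 7); C = (Reg 2, Reg 5, Reg 8)
    in [A, B, C, tplus A B, tplus A C, tplus B C])"

text \<open>The \<open>36\<close> linear forms to be squared, in blocks of six.\<close>

definition inv_forms :: "nat lexp list" where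
  "inv_forms = concat (map sq_forms inv_inputs)"

text \<open>Three elements of \<open>K[u]\<close>, the coefficients of \<open>1, v, v\<^sup>2\<close>, are arranged as a coordinate vector.\<close>

fun interleave :: "'r triple \<Rightarrow> 'r triple \<Rightarrow> 'r triple \<Rightarrow> 'r lexp list" where
  "interleave (a0, a1, a2) (b0, b1, b2) (c0, c1, c2) = [a0, b0, c0, a1, b1, c1, a2, b2, c2]"

text \<open>The coordinates of \<open>(A\<^sup>2 - u B C) + (u C\<^sup>2 - A B) v + (B\<^sup>2 - A C) v\<^sup>2\<close>.\<close>

definition inv_outputs :: "nat lexp list" where
  "inv_outputs = interleave
    (tminus (sq_triple 0) (tshift (prod_triple 5 1 2)))
    (tminus (tshift (sq_triple 2)) (prod_triple 3 0 1))
    (tminus (sq_triple 1) (prod_triple 4 0 2))"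

definition inv_slp :: slp where "inv_slp = quad_slp inv_forms inv_outputs"

lemma quotient_of_half: "quotient_of (1/2) = (1, 2)"
  by (simp add: Fract_of_int_quotient[of 1 2, simplified, symmetric] quotient_of_Fract normalize_def)

lemma small_rats: "small_rat (- 1)" "small_rat 7" "small_rat (1/2)"
  by (simp_all add: small_rat_def quotient_of_half)

lemma inv_forms_wf: "\<forall>e\<in>set inv_forms. wf_lexp 9 e" "length inv_forms = 36"
  by (simp_all add: inv_forms_def inv_inputs_def wf_lexp_def)

lemma inv_outputs_wf: "\<forall>e\<in>set inv_outputs. wf_lexp 36 e" "length inv_outputs = 9"
  by (simp_all add: inv_outputs_def prod_triple_def sq_triple_def Let_def wf_lexp_def small_rats)

context cubic_tower_field
begin

definition half :: 'a where "half = inv (\<one> \<oplus> \<one>)"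

lemma two_nonzero: "\<one> \<oplus> \<one> \<noteq> \<zero>"
proof
  assume two: "\<one> \<oplus> \<one> = \<zero>"
  have "odd p" using prime_p p_gt_3 prime_odd_nat by simp
  then obtain m where m: "p = Suc (2 * m)" using oddE by fastforce
  have "add_pow L (2 * m) \<one> = \<zero>"
    using two by (induction m) simp_all
  with char_p show False unfolding m by simp
qed

lemma half_K [simp]: "half \<in> K"
  unfolding half_def using two_nonzero by simp

lemma half_double: assumes "x \<in> carrier L" shows "half \<otimes> (x \<oplus> x) = x"
proof -
  have "half \<otimes> (x \<oplus> x) = (half \<otimes> (\<one> \<oplus> \<one>)) \<otimes> x"
    using assms by (simp add: l_distr r_distr)
  also have "half \<otimes> (\<one> \<oplus> \<one>) = \<one>"
    unfolding half_def using two_nonzero by (simp add: field_Units)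
  finally show ?thesis using assms by simp
qed

lemma rat_in_simps [simp]:
  "rat_in L (- 1) = \<ominus> \<one>" "rat_in L 7 = seven" "rat_in L (1/2) = half"
proof -
  show "rat_in L 7 = seven"
    by (simp add: rat_in_def seven_def add_pow_int_ge)
  show "rat_in L (1/2) = half"
    using K_closed[OF half_K]
    by (simp add: rat_in_def quotient_of_half half_def add_pow_int_ge numeral_2_eq_2)
  show "rat_in L (- 1) = \<ominus> \<one>"
    by (simp add: rat_in_def add_pow_int_ge add_pow_int_lt)
qed

text \<open>The element of \<open>K[u]\<close> denoted by a triple when \<open>\<rho>\<close> gives the contents of the registers.\<close>

fun tval :: "('r \<Rightarrow> 'a) \<Rightarrow> 'r triple \<Rightarrow> 'a" where
  "tval \<rho> (a, b, c) = ev L \<rho> a \<oplus> ev L \<rho> b \<otimes> u \<oplus> ev L \<rho> c \<otimes> (u \<otimes> u)"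

text \<open>The values of all three components are in \<open>K\<close>.\<close>

fun tclosed :: "('r \<Rightarrow> 'a) \<Rightarrow> 'r triple \<Rightarrow> bool" where
  "tclosed \<rho> (a, b, c) \<longleftrightarrow> ev L \<rho> a \<in> K \<and> ev L \<rho> b \<in> K \<and> ev L \<rho> c \<in> K"

lemma minus_K: "a \<in> K \<Longrightarrow> \<ominus> \<one> \<otimes> a = \<ominus> a"
  by (simp add: l_minus)

lemma tclosed_ops [simp]:
  "tclosed \<rho> S \<Longrightarrow> tclosed \<rho> T \<Longrightarrow> tclosed \<rho> (tplus S T)"
  "tclosed \<rho> S \<Longrightarrow> tclosed \<rho> T \<Longrightarrow> tclosed \<rho> (tminus S T)"
  "tclosed \<rho> T \<Longrightarrow> tclosed \<rho> (thalf T)"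
  "tclosed \<rho> T \<Longrightarrow> tclosed \<rho> (tshift T)"
  by (cases S; cases T; simp)+

lemma tval_closed [simp]: "tclosed \<rho> T \<Longrightarrow> tval \<rho> T \<in> carrier L"
  by (cases T) simp

lemma tval_plus: "tclosed \<rho> S \<Longrightarrow> tclosed \<rho> T \<Longrightarrow> tval \<rho> (tplus S T) = tval \<rho> S \<oplus> tval \<rho> T"
  by (cases S; cases T) (simp add: l_distr a_ac)

lemma tval_minus: "tclosed \<rho> S \<Longrightarrow> tclosed \<rho> T \<Longrightarrow> tval \<rho> (tminus S T) = tval \<rho> S \<ominus> tval \<rho> T"
  by (cases S; cases T) (simp add: l_distr a_ac minus_K l_minus minus_add minus_eq)

lemma tval_half: "tclosed \<rho> T \<Longrightarrow> tval \<rho> (thalf T) = half \<otimes> tval \<rho> T"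
  by (cases T) (simp add: r_distr m_assoc)

lemma u_cubed': "u \<otimes> (u \<otimes> u) = seven"
  using u_cubed by (simp add: numeral_3_eq_3 m_assoc)

lemma tval_shift: "tclosed \<rho> T \<Longrightarrow> tval \<rho> (tshift T) = u \<otimes> tval \<rho> T"
  by (cases T) (simp add: u_cubed'[symmetric] r_distr m_ac a_ac)

lemma sq_triple:
  assumes T: "tclosed \<rho> T"
    and \<tau>: "\<And>i. i < 6 \<Longrightarrow> \<tau> (6 * k + i) = ev L \<rho> (sq_forms T ! i) \<otimes> ev L \<rho> (sq_forms T ! i)"
  shows "tclosed \<tau> (sq_triple k)" "tval \<tau> (sq_triple k) = tval \<rho> T \<otimes> tval \<rho> T"
proof -
  obtain a b c where abc: "T = (a, b, c)" by (cases T)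
  define x y z where xyz: "x = ev L \<rho> a" "y = ev L \<rho> b" "z = ev L \<rho> c"
  have K: "x \<in> K" "y \<in> K" "z \<in> K" using T unfolding abc xyz by simp_all
  have s: "\<tau> (6 * k) = x \<otimes> x" "\<tau> (6 * k + 1) = y \<otimes> y" "\<tau> (6 * k + 2) = z \<otimes> z"
    "\<tau> (6 * k + 3) = (x \<oplus> y) \<otimes> (x \<oplus> y)" "\<tau> (6 * k + 4) = (x \<oplus> z) \<otimes> (x \<oplus> z)"
    "\<tau> (6 * k + 5) = (y \<oplus> z) \<otimes> (y \<oplus> z)"
    using \<tau>[of 0] \<tau>[of 1] \<tau>[of 2] \<tau>[of 3] \<tau>[of 4] \<tau>[of 5] by (simp_all add: abc xyz)
  have pol: "(e \<oplus> f) \<otimes> (e \<oplus> f) \<oplus> \<ominus> (e \<otimes> e) \<oplus> \<ominus> (f \<otimes> f) = e \<otimes> f \<oplus> e \<otimes> f"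
    if "e \<in> K" "f \<in> K" for e f
    using polarization[of e f] that by (simp add: minus_eq)
  show "tclosed \<tau> (sq_triple k)"
    using K by (simp add: sq_triple_def Let_def s[simplified])
  have sq: "tval \<tau> (sq_triple k) = 
      (x \<otimes> x \<oplus> seven \<otimes> (y \<otimes> z \<oplus> y \<otimes> z)) \<oplus> (x \<otimes> y \<oplus> x \<otimes> y \<oplus> seven \<otimes> (z \<otimes> z)) \<otimes> u
       \<oplus> (y \<otimes> y \<oplus> (x \<otimes> z \<oplus> x \<otimes> z)) \<otimes> (u \<otimes> u)"
    using K by (simp add: sq_triple_def Let_def s[simplified] minus_K pol)
  have tv: "tval \<rho> T = x \<oplus> y \<otimes> u \<oplus> z \<otimes> (u \<otimes> u)" by (simp add: abc xyz)
  have "tval \<rho> T \<otimes> tval \<rho> T =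
      (x \<otimes> x \<oplus> (y \<otimes> u \<otimes> (z \<otimes> (u \<otimes> u)) \<oplus> y \<otimes> u \<otimes> (z \<otimes> (u \<otimes> u))))
      \<oplus> (x \<otimes> (y \<otimes> u) \<oplus> x \<otimes> (y \<otimes> u) \<oplus> z \<otimes> (u \<otimes> u) \<otimes> (z \<otimes> (u \<otimes> u)))
      \<oplus> (y \<otimes> u \<otimes> (y \<otimes> u) \<oplus> (x \<otimes> (z \<otimes> (u \<otimes> u)) \<oplus> x \<otimes> (z \<otimes> (u \<otimes> u))))"
    unfolding tv using K by (intro square_trinomial) auto
  also have "y \<otimes> u \<otimes> (z \<otimes> (u \<otimes> u)) = seven \<otimes> (y \<otimes> z)"
    using K by (simp add: u_cubed'[symmetric] m_ac)
  also have "z \<otimes> (u \<otimes> u) \<otimes> (z \<otimes> (u \<otimes> u)) = seven \<otimes> (z \<otimes> z) \<otimes> u"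
    using K by (simp add: u_cubed'[symmetric] m_ac)
  also have "x \<otimes> (y \<otimes> u) = x \<otimes> y \<otimes> u" using K by (simp add: m_assoc)
  also have "y \<otimes> u \<otimes> (y \<otimes> u) = y \<otimes> y \<otimes> (u \<otimes> u)" using K by (simp add: m_ac)
  also have "x \<otimes> (z \<otimes> (u \<otimes> u)) = x \<otimes> z \<otimes> (u \<otimes> u)" using K by (simp add: m_assoc)
  finally show "tval \<tau> (sq_triple k) = tval \<rho> T \<otimes> tval \<rho> T"
    unfolding sq using K by (simp add: l_distr r_distr)
qed

lemma from_coords_list:
  assumes "set [r0, s0, t0, r1, s1, t1, r2, s2, t2] \<subseteq> K"
  shows "from_coords L u v [r0, s0, t0, r1, s1, t1, r2, s2, t2] =
    (r0 \<oplus> r1 \<otimes> u \<oplus> r2 \<otimes> (u \<otimes> u)) \<oplus> (s0 \<oplus> s1 \<otimes> u \<oplus> s2 \<otimes> (u \<otimes> u)) \<otimes> v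
      \<oplus> (t0 \<oplus> t1 \<otimes> u \<oplus> t2 \<otimes> (u \<otimes> u)) \<otimes> (v \<otimes> v)"
proof -
  have K: "r0 \<in> carrier L" "s0 \<in> carrier L" "t0 \<in> carrier L" "r1 \<in> carrier L" "s1 \<in> carrier L"
    "t1 \<in> carrier L" "r2 \<in> carrier L" "s2 \<in> carrier L" "t2 \<in> carrier L" using assms by auto
  have sum3: "(\<Oplus>i\<in>{..<3}. f i) = f 0 \<oplus> f 1 \<oplus> f 2"
    if "f 0 \<in> carrier L" "f 1 \<in> carrier L" "f 2 \<in> carrier L" for f :: "nat \<Rightarrow> 'a"
  proof -
    have "{..<3::nat} = {0, 1, 2}" by auto
    then show ?thesis using that by (simp add: a_assoc)
  qed
  have regroup: "(x0 \<oplus> y0 \<oplus> z0) \<oplus> (x1 \<oplus> y1 \<oplus> z1) \<oplus> (x2 \<oplus> y2 \<oplus> z2) =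
      (x0 \<oplus> x1 \<oplus> x2) \<oplus> (y0 \<oplus> y1 \<oplus> y2) \<oplus> (z0 \<oplus> z1 \<oplus> z2)"
    if "x0 \<in> carrier L" "x1 \<in> carrier L" "x2 \<in> carrier L" "y0 \<in> carrier L" "y1 \<in> carrier L"
      "y2 \<in> carrier L" "z0 \<in> carrier L" "z1 \<in> carrier L" "z2 \<in> carrier L"
    for x0 x1 x2 y0 y1 y2 z0 z1 z2
    using that by (simp add: a_ac)
  have "from_coords L u v [r0, s0, t0, r1, s1, t1, r2, s2, t2] =
      (r0 \<oplus> s0 \<otimes> v \<oplus> t0 \<otimes> (v \<otimes> v))
      \<oplus> (r1 \<otimes> u \<oplus> s1 \<otimes> u \<otimes> v \<oplus> t1 \<otimes> u \<otimes> (v \<otimes> v))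
      \<oplus> (r2 \<otimes> (u \<otimes> u) \<oplus> s2 \<otimes> (u \<otimes> u) \<otimes> v \<oplus> t2 \<otimes> (u \<otimes> u) \<otimes> (v \<otimes> v))"
    using K by (simp add: from_coords_def sum3 numeral_2_eq_2 m_assoc)
  then show ?thesis using K by (simp add: regroup l_distr)
qed

lemma from_coords_interleave:
  assumes "tclosed \<rho> R" "tclosed \<rho> S" "tclosed \<rho> T"
  shows "map (ev L \<rho>) (interleave R S T) \<in> vecs"
    "from_coords L u v (map (ev L \<rho>) (interleave R S T)) =
      tval \<rho> R \<oplus> tval \<rho> S \<otimes> v \<oplus> tval \<rho> T \<otimes> (v \<otimes> v)"
  using assms by (cases R; cases S; cases T; simp add: vecs_def from_coords_list)+

text \<open>On input \<open>a + b v + c v\<^sup>2\<close> with \<open>a, b, c\<close> in \<open>K[u]\<close>, the program returns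
  \<open>(a\<^sup>2 - u b c) + (u c\<^sup>2 - a b) v + (b\<^sup>2 - a c) v\<^sup>2\<close>.\<close>

lemma run_inv_slp:
  assumes c: "c \<in> vecs"
  obtains A B C :: "nat triple" where "tclosed ((!) c) A" "tclosed ((!) c) B" "tclosed ((!) c) C"
    "from_coords L u v c = tval ((!) c) A \<oplus> tval ((!) c) B \<otimes> v \<oplus> tval ((!) c) C \<otimes> (v \<otimes> v)"
    "run L inv_slp [] c \<in> vecs"
    "from_coords L u v (run L inv_slp [] c) =
      (tval ((!) c) A \<otimes> tval ((!) c) A \<ominus> u \<otimes> (tval ((!) c) B \<otimes> tval ((!) c) C))
      \<oplus> (u \<otimes> (tval ((!) c) C \<otimes> tval ((!) c) C) \<ominus> tval ((!) c) A \<otimes> tval ((!) c) B) \<otimes> v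
      \<oplus> (tval ((!) c) B \<otimes> tval ((!) c) B \<ominus> tval ((!) c) A \<otimes> tval ((!) c) C) \<otimes> (v \<otimes> v)"
proof -
  let ?\<rho> = "(!) c"
  define A B C :: "nat triple" where ABC: "A = (Reg 0, Reg 3, Reg 6)" "B = (Reg 1, Reg 4, Reg 7)"
    "C = (Reg 2, Reg 5, Reg 8)"
  have K: "tclosed ?\<rho> A" "tclosed ?\<rho> B" "tclosed ?\<rho> C"
    using vecsD(2)[OF c] by (simp_all add: ABC)
  \<comment> \<open>The triples \<open>A, B, C\<close> read off the input.\<close>
  have "map ((!) c) [0..<length c] = c" by (rule map_nth)
  then have cs: "map (ev L ?\<rho>) (interleave A B C) = c"
    by (simp add: ABC vecsD(1)[OF c] upt_rec numeral_eq_Suc)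
  let ?\<tau> = "\<lambda>i. ev L ?\<rho> (inv_forms ! i) \<otimes> ev L ?\<rho> (inv_forms ! i)"
  let ?a = "tval ?\<rho> A" and ?b = "tval ?\<rho> B" and ?c = "tval ?\<rho> C"
  have forms: "inv_forms = sq_forms A @ sq_forms B @ sq_forms C @ sq_forms (tplus A B) @
      sq_forms (tplus A C) @ sq_forms (tplus B C)"
    by (simp add: inv_forms_def inv_inputs_def ABC)
  have len: "length (sq_forms T) = 6" for T :: "nat triple" by (cases T) simp
  have nth: "inv_forms ! (6 * 0 + i) = sq_forms A ! i" "inv_forms ! (6 * 1 + i) = sq_forms B ! i"
    "inv_forms ! (6 * 2 + i) = sq_forms C ! i" "inv_forms ! (6 * 3 + i) = sq_forms (tplus A B) ! i"
    "inv_forms ! (6 * 4 + i) = sq_forms (tplus A C) ! i"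
    "inv_forms ! (6 * 5 + i) = sq_forms (tplus B C) ! i" if "i < 6" for i
    using that unfolding forms by (simp_all add: nth_append len)
  have sq0: "tclosed ?\<tau> (sq_triple 0)" "tval ?\<tau> (sq_triple 0) = ?a \<otimes> ?a"
    using sq_triple[of ?\<rho> A ?\<tau> 0] K by (simp_all only: nth)
  have sq1: "tclosed ?\<tau> (sq_triple 1)" "tval ?\<tau> (sq_triple 1) = ?b \<otimes> ?b"
    using sq_triple[of ?\<rho> B ?\<tau> 1] K by (simp_all only: nth)
  have sq2: "tclosed ?\<tau> (sq_triple 2)" "tval ?\<tau> (sq_triple 2) = ?c \<otimes> ?c"
    using sq_triple[of ?\<rho> C ?\<tau> 2] K by (simp_all only: nth)
  have sq3: "tclosed ?\<tau> (sq_triple 3)" "tval ?\<tau> (sq_triple 3) = (?a \<oplus> ?b) \<otimes> (?a \<oplus> ?b)"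
    using sq_triple[of ?\<rho> "tplus A B" ?\<tau> 3] K by (simp_all only: nth tclosed_ops tval_plus)
  have sq4: "tclosed ?\<tau> (sq_triple 4)" "tval ?\<tau> (sq_triple 4) = (?a \<oplus> ?c) \<otimes> (?a \<oplus> ?c)"
    using sq_triple[of ?\<rho> "tplus A C" ?\<tau> 4] K by (simp_all only: nth tclosed_ops tval_plus)
  have sq5: "tclosed ?\<tau> (sq_triple 5)" "tval ?\<tau> (sq_triple 5) = (?b \<oplus> ?c) \<otimes> (?b \<oplus> ?c)"
    using sq_triple[of ?\<rho> "tplus B C" ?\<tau> 5] K by (simp_all only: nth tclosed_ops tval_plus)
  note sqs = sq0 sq1 sq2 sq3 sq4 sq5
  have prod: "tclosed ?\<tau> (prod_triple 3 0 1)" "tval ?\<tau> (prod_triple 3 0 1) = ?a \<otimes> ?b"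
    "tclosed ?\<tau> (prod_triple 4 0 2)" "tval ?\<tau> (prod_triple 4 0 2) = ?a \<otimes> ?c"
    "tclosed ?\<tau> (prod_triple 5 1 2)" "tval ?\<tau> (prod_triple 5 1 2) = ?b \<otimes> ?c"
    using K sqs by (simp_all only: prod_triple_def tclosed_ops tval_half tval_minus polarization
      half_double tval_closed m_closed)
  have run: "run L inv_slp [] c = map (ev L ?\<tau>) inv_outputs"
    unfolding inv_slp_def using inv_forms_wf inv_outputs_wf vecsD(1)[OF c]
    by (intro quad_slp_correct(5)) simp_all
  note out = from_coords_interleave[of ?\<tau> "tminus (sq_triple 0) (tshift (prod_triple 5 1 2))"
    "tminus (tshift (sq_triple 2)) (prod_triple 3 0 1)" "tminus (sq_triple 1) (prod_triple 4 0 2)",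
    folded inv_outputs_def run]
  show thesis
  proof (rule that[OF K])
    show "from_coords L u v c = ?a \<oplus> ?b \<otimes> v \<oplus> ?c \<otimes> (v \<otimes> v)"
      using from_coords_interleave(2)[OF K] unfolding cs .
    show "run L inv_slp [] c \<in> vecs" using sqs prod by (intro out) simp_all
    show "from_coords L u v (run L inv_slp [] c) =
      (?a \<otimes> ?a \<ominus> u \<otimes> (?b \<otimes> ?c)) \<oplus> (u \<otimes> (?c \<otimes> ?c) \<ominus> ?a \<otimes> ?b) \<otimes> v
      \<oplus> (?b \<otimes> ?b \<ominus> ?a \<otimes> ?c) \<otimes> (v \<otimes> v)"
      using sqs prod by (subst out) (simp_all only: tclosed_ops tval_minus tval_shift)
  qed
qed

text \<open>The \<open>p ^ 3\<close>-Frobenius map multiplies \<open>v\<close> by a cube root of unity, which is primitive because the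
  map is not the identity: \<open>x ^ (p ^ 3 - 1) = 1\<close> has at most \<open>p ^ 3 - 1\<close> solutions.\<close>

lemma frobenius_3_generator:
  obtains w where "w \<in> K" "w \<otimes> w \<otimes> w = \<one>" "w \<oplus> w \<otimes> w = \<ominus> \<one>" "v [^] (p ^ 3) = w \<otimes> v"
proof -
  obtain t where t: "p ^ 3 = 9 * t + 1" "(p - 1) dvd 3 * t" using cube_factor[of 3] by blast
  define w where "w = seven [^] t"
  have wK: "w \<in> K" unfolding w_def by simp
  have vq: "v [^] (p ^ 3) = w \<otimes> v"
  proof -
    have "p ^ 3 div 9 = t" "p ^ 3 mod 9 = 1" unfolding t(1) by presburger+
    then show ?thesis using v_pow_reduce[of "p ^ 3"] by (simp add: w_def)
  qed
  have "w [^] (3::nat) = \<one>"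
    using seven_pow_eq_one[OF t(2)] by (simp add: w_def nat_pow_pow mult.commute)
  then have w3: "w \<otimes> w \<otimes> w = \<one>" using wK by (simp add: numeral_3_eq_3)
  have "w \<noteq> \<one>"
  proof
    assume "w = \<one>"
    then have vq: "v [^] (p ^ 3) = v" using vq by simp
    have fixed: "a [^] (p ^ 3) = a" if "a \<in> carrier L" for a
    proof -
      obtain c where c: "c \<in> vecs" "a = from_coords L u v c" using coords_obtain \<open>a \<in> carrier L\<close> by blast
      have a: "a = (\<Oplus>k\<in>{..<9}. c ! k \<otimes> v [^] k)"
        using c by (simp add: from_coords_expand vecsD)
      have "(v [^] k) [^] (p ^ 3) = v [^] k" for k :: nat
      proof -
        have "(v [^] k) [^] (p ^ 3) = (v [^] (p ^ 3)) [^] k" by (simp add: nat_pow_pow mult.commute)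
        then show ?thesis by (simp only: vq)
      qed
      then have "(c ! k \<otimes> v [^] k) [^] (p ^ 3) = c ! k \<otimes> v [^] k" if "k < 9" for k
        using vecsD(2)[OF c(1) that] by (simp add: nat_pow_distrib K_frobenius)
      then show ?thesis
        unfolding a using c vecsD(2)[OF c(1)]
        by (subst frobenius_finsum[OF prime_p char_p]) (auto intro!: finsum_cong')
    qed
    have "a [^] (p ^ 3 - 1) = \<one>" if "a \<in> carrier L - {\<zero>}" for a
    proof -
      have "a [^] (p ^ 3 - 1) \<otimes> a = a [^] Suc (p ^ 3 - 1)" by simp
      also have "\<dots> = \<one> \<otimes> a" using fixed[of a] that p_pos by simp
      finally show ?thesis using that m_rcancel[of a "a [^] (p ^ 3 - 1)" \<one>] by simp
    qed
    then have sub: "carrier L - {\<zero>} \<subseteq> {a \<in> carrier L. a [^] (p ^ 3 - 1) = \<one>}" by blast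
    have p3: "p ^ 3 > 1" using p_gt_3 by (intro one_less_power) auto
    have "p ^ 9 - 1 = card (carrier L - {\<zero>})"
      using order_L finite_L by (simp add: order_def)
    also have "\<dots> \<le> card {a \<in> carrier L. a [^] (p ^ 3 - 1) = \<one>}"
      using sub finite_L by (intro card_mono) auto
    also have "\<dots> \<le> p ^ 3 - 1"
      using p3 by (intro num_roots_le_deg finite_L) simp
    finally have "p ^ 9 \<le> p ^ 3" using p3 by simp
    then show False using p_gt_3 power_strict_increasing[of 3 9 p] by simp
  qed
  moreover have "(w \<ominus> \<one>) \<otimes> (w \<otimes> w \<oplus> w \<oplus> \<one>) = \<zero>"
  proof -
    have "(w \<ominus> \<one>) \<otimes> (w \<otimes> w \<oplus> w \<oplus> \<one>) = w \<otimes> w \<otimes> w \<ominus> \<one>"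
      using K_closed[OF wK] by algebra
    then show ?thesis using w3 by (simp add: minus_eq r_neg)
  qed
  ultimately have "w \<otimes> w \<oplus> w \<oplus> \<one> = \<zero>"
    using wK integral[of "w \<ominus> \<one>" "w \<otimes> w \<oplus> w \<oplus> \<one>"] by (simp add: r_right_minus_eq)
  then have "w \<oplus> w \<otimes> w = \<ominus> \<one>"
    using wK by (intro minus_equality[symmetric]) (simp_all add: a_ac)
  with wK w3 vq show thesis using that by blast
qed

text \<open>The two conjugates of \<open>x\<close> over \<open>K[u]\<close> other than \<open>x\<close> itself have a product that is quadratic
  in \<open>a, b, c\<close>.\<close>

lemma conjugates_product:
  assumes T: "tclosed \<rho> A" "tclosed \<rho> B" "tclosed \<rho> C"
    and a: "a = tval \<rho> A" "b = tval \<rho> B" "c = tval \<rho> C"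
    and x: "x = a \<oplus> b \<otimes> v \<oplus> c \<otimes> (v \<otimes> v)"
  shows "x [^] (p ^ 3) \<otimes> x [^] (p ^ 6) =
    (a \<otimes> a \<ominus> u \<otimes> (b \<otimes> c)) \<oplus> (u \<otimes> (c \<otimes> c) \<ominus> a \<otimes> b) \<otimes> v \<oplus> (b \<otimes> b \<ominus> a \<otimes> c) \<otimes> (v \<otimes> v)"
proof -
  obtain w where w: "w \<in> K" "w \<otimes> w \<otimes> w = \<one>" "w \<oplus> w \<otimes> w = \<ominus> \<one>" "v [^] (p ^ 3) = w \<otimes> v"
    by (rule frobenius_3_generator)
  have cl [simp]: "a \<in> carrier L" "b \<in> carrier L" "c \<in> carrier L" "w \<in> carrier L"
    using T w(1) by (simp_all add: a)
  let ?F = "\<lambda>x. x [^] (p ^ 3)"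
  have F_add: "?F (x \<oplus> y) = ?F x \<oplus> ?F y" if "x \<in> carrier L" "y \<in> carrier L" for x y
    using that by (rule frobenius_add[OF prime_p char_p])
  have F_mult: "?F (x \<otimes> y) = ?F x \<otimes> ?F y" if "x \<in> carrier L" "y \<in> carrier L" for x y
    using that by (rule nat_pow_distrib)
  have w4: "w \<otimes> (w \<otimes> (w \<otimes> z)) = z" if "z \<in> carrier L" for z
    using w(2) that by (simp add: m_assoc[symmetric])
  have uv: "v \<otimes> (v \<otimes> v) = u" using v_cubed by (simp add: numeral_3_eq_3 m_assoc)
  have Fu: "?F u = u"
  proof -
    have "?F u = ?F (v \<otimes> (v \<otimes> v))" by (simp only: uv)
    also have "\<dots> = w \<otimes> (w \<otimes> (w \<otimes> (v \<otimes> (v \<otimes> v))))" by (simp add: F_mult w(4) m_ac)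
    finally show ?thesis by (simp add: w4 uv)
  qed
  have Ftval: "?F (tval \<rho> S) = tval \<rho> S" if "tclosed \<rho> S" for S :: "'b triple"
    using that by (cases S) (simp add: F_add F_mult Fu K_frobenius)
  have Fabc: "?F a = a" "?F b = b" "?F c = c" using T Ftval by (simp_all add: a)
  have Fw: "?F w = w" using w(1) by (rule K_frobenius)
  have F1: "?F x = a \<oplus> w \<otimes> (b \<otimes> v) \<oplus> w \<otimes> w \<otimes> (c \<otimes> (v \<otimes> v))"
    by (simp add: x F_add F_mult Fabc w(4) m_ac)
  have "x [^] (p ^ 6) = ?F (?F x)"
    by (simp add: x nat_pow_pow power_add[symmetric])
  also have "\<dots> = a \<oplus> w \<otimes> w \<otimes> (b \<otimes> v) \<oplus> w \<otimes> (c \<otimes> (v \<otimes> v))"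
    unfolding F1 by (simp add: F_add F_mult Fabc Fw w(4) m_ac w4)
  finally have F2: "x [^] (p ^ 6) = \<dots>" .
  let ?y = "b \<otimes> v" and ?z = "c \<otimes> (v \<otimes> v)"
  have sq: "?y \<otimes> ?y = b \<otimes> b \<otimes> (v \<otimes> v)" "?z \<otimes> ?z = u \<otimes> (c \<otimes> c) \<otimes> v"
    "a \<otimes> ?y = a \<otimes> b \<otimes> v" "a \<otimes> ?z = a \<otimes> c \<otimes> (v \<otimes> v)" "?y \<otimes> ?z = u \<otimes> (b \<otimes> c)"
    by (simp_all add: uv[symmetric] m_ac)
  have "x [^] (p ^ 3) \<otimes> x [^] (p ^ 6) =
      a \<otimes> a \<oplus> ?y \<otimes> ?y \<oplus> ?z \<otimes> ?z \<ominus> a \<otimes> ?y \<ominus> a \<otimes> ?z \<ominus> ?y \<otimes> ?z"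
    unfolding F1 F2 using w by (intro conjugate_product) simp_all
  also have "\<dots> = (a \<otimes> a \<ominus> u \<otimes> (b \<otimes> c)) \<oplus> (u \<otimes> (c \<otimes> c) \<ominus> a \<otimes> b) \<otimes> v
      \<oplus> (b \<otimes> b \<ominus> a \<otimes> c) \<otimes> (v \<otimes> v)"
    unfolding sq by (simp add: minus_eq l_distr l_minus a_ac)
  finally show ?thesis .
qed

lemma inverse_eq:
  assumes "x \<in> G_phi3 L p" shows "inv x = x [^] (p ^ 3) \<otimes> x [^] (p ^ 6)"
proof -
  have x: "x \<in> carrier L" "x [^] (p ^ 6 + p ^ 3 + 1) = \<one>" using assms by (auto simp: G_phi3_def)
  have "x \<otimes> (x [^] (p ^ 3) \<otimes> x [^] (p ^ 6)) = x [^] (p ^ 6 + p ^ 3 + 1)"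
    using x(1) by (simp add: nat_pow_mult[symmetric] m_ac)
  then show ?thesis using x by (intro comm_inv_char) auto
qed

lemma inverse_costs:
  assumes "inv_slp \<in> Ps" shows "costs Ps L K u v (G_phi3 L p) (\<lambda>x. inv x) 0 36"
proof (rule costs_from_coordsI[OF assms, where ks = "[]"])
  fix c assume c: "c \<in> vecs" and G: "from_coords L u v c \<in> G_phi3 L p"
  from run_inv_slp[OF c] show "run L inv_slp [] c \<in> vecs \<and>
      from_coords L u v (run L inv_slp [] c) = inv (from_coords L u v c)"
    unfolding inverse_eq[OF G] by (metis conjugates_product)
qed (use inv_forms_wf inv_outputs_wf in
  \<open>auto simp: inv_slp_def G_phi3_def quad_slp_correct\<close>)

end

section \<open>The operation counts\<close>

theorem lemma3p1:
  shows "\<exists>Ps. finite Ps \<and>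
    (\<forall>p (L :: 'a ring) K u v.
       Factorial_Ring.prime p \<and> p > 3 \<and> [p = 1] (mod 3) \<and>
       cubic_tower p L K u v \<and> pirreducible\<^bsub>L\<^esub> K (X3_minus_7 L) \<longrightarrow>
         (\<forall>i\<in>{3, 6}. costs Ps L K u v (carrier L) (frobenius L p i) 6 0) \<and>
         (\<forall>i\<in>{1, 2, 4, 5, 7, 8}. costs Ps L K u v (carrier L) (frobenius L p i) 8 0) \<and>
         (\<forall>\<alpha>\<in>G_phi3 L p. inv\<^bsub>L\<^esub> \<alpha> = \<alpha> [^]\<^bsub>L\<^esub> (p ^ 3) \<otimes>\<^bsub>L\<^esub> \<alpha> [^]\<^bsub>L\<^esub> (p ^ 6)) \<and>
         costs Ps L K u v (G_phi3 L p) (\<lambda>\<alpha>. inv\<^bsub>L\<^esub> \<alpha>) 0 36)"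
proof (intro exI conjI allI impI)
  let ?Ps = "{frob_slp 1, frob_slp 4, frob_slp 7, omega_slp, inv_slp}"
  show "finite ?Ps" by simp
  fix p :: nat and L :: "'a ring" and K u v
  assume *: "Factorial_Ring.prime p \<and> p > 3 \<and> [p = 1] (mod 3) \<and>
       cubic_tower p L K u v \<and> pirreducible\<^bsub>L\<^esub> K (X3_minus_7 L)"
  then interpret cubic_tower_field L p K u v
    by (auto simp: cubic_tower_field_def cubic_tower_field_axioms_def cubic_tower_def)
  show "\<forall>i\<in>{3, 6}. costs ?Ps L K u v (carrier L) (frobenius L p i) 6 0"
    using omega_costs by simp
  show "\<forall>i\<in>{1, 2, 4, 5, 7, 8}. costs ?Ps L K u v (carrier L) (frobenius L p i) 8 0"
    using frob_costs_all by simp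
  show "\<forall>\<alpha>\<in>G_phi3 L p. inv\<^bsub>L\<^esub> \<alpha> = \<alpha> [^]\<^bsub>L\<^esub> (p ^ 3) \<otimes>\<^bsub>L\<^esub> \<alpha> [^]\<^bsub>L\<^esub> (p ^ 6)"
    using inverse_eq by blast
  show "costs ?Ps L K u v (G_phi3 L p) (\<lambda>\<alpha>. inv\<^bsub>L\<^esub> \<alpha>) 0 36"
    by (rule inverse_costs) simp
qed

end
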